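(* For any consistent RE theory $T$, the following statements are equivalent: (1) $T$ is EI; (2) $T$ is tEI; (3) $T$ is EET.
   Context: All theories are first-order theories (with equality) in finite signatures and are recursively enumerable (RE). A theory is identified with the set of sentences provable in it. A Gödel numbering of sentences is fixed and a set of sentences is identified with the set of Gödel numbers of its elements. $W_i$ denotes the RE set with index $i$. "Recursive function" means partial recursive function. For a theory $T$, $T_P=\{\phi : T\vdash\phi\}$ and $T_R=\{\phi: T\vdash\neg\phi\}$ (as $\phi$ ranges over sentences of the language of $T$). EI. A pair $(A,B)$ of disjoint RE sets of natural numbers is effectively inseparable (EI) if there is a recursive function $f(x,y)$ such that for all $i,j$, if $A\subseteq W_i$, $B\subseteq W_j$ and $W_i\cap W_j=\emptyset$, then $f(i,j)$ converges and $f(i,j)\notin W_i\cup W_j$. A consistent RE theory $T$ is EI if $(T_P,T_R)$ is an EI pair. Filter and ideal. A set $X$ of sentences is a filter if (1) $\alpha\in X$ and $\alpha\vdash\beta$ imply $\beta\in X$; (2) $\alpha,\beta\in X$ imply $\alpha\wedge\beta\in X$; (3) $\bot\notin X$. A set $Y$ of sentences is an ideal if (A) $\alpha\in Y$ and $\beta\vdash\alpha$ imply $\beta\in Y$; (B) $\alpha,\beta\in Y$ imply $\alpha\vee\beta\in Y$; (C) $\top\notin Y$. tEI. An RE theory $T$ is tEI if there is a recursive function $f$ such that whenever $X$ is an RE filter of sentences with index $i$, $Y$ is an RE ideal of sentences with index $j$, $T_P\subseteq X$, $T_R\subseteq Y$ and $X\cap Y=\emptyset$, then $f(i,j)$ converges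 and outputs a sentence with $f(i,j)\notin X\cup Y$. EET. A consistent RE theory $T$ is effectively extensible (EET) if there is a recursive function $f$ such that whenever $i$ is the index of a consistent RE extension $S$ of $T$ (in the same language, $S$ identified with its set of theorems), $f(i)$ converges and outputs a sentence which is independent of $S$ (neither provable nor refutable in $S$). *)

theory Defs
  imports Main "HOL-Library.Nat_Bijection"
begin

section \<open>Partial recursive functions and RE sets\<close>

text \<open>Descriptions of partial recursive functions. The arity is not recorded: it is the length of
  the argument list, so one description denotes a partial function of every arity.\<close>

datatype recf =
    Zero
  | Succ
  | Proj nat
  | Comp recf "recf list"
  | Prim recf recf
  | Mu recf

text \<open>Partial functions have values in option types, with \<open>None\<close> for divergence. Composition is
  strict, since \<open>those\<close> returns \<open>None\<close> if some list element is \<open>None\<close>. Primitive recursion is on the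
  first argument: \<open>h(0,ys) = f(ys)\<close> and \<open>h(m+1,ys) = g(m,h(m,ys),ys)\<close>. Minimisation is over the
  first argument, and the values below the least zero have to be defined.\<close>

primrec eval :: "recf \<Rightarrow> nat list \<Rightarrow> nat option" where
  "eval Zero xs = Some 0"
| "eval Succ xs = (case xs of [] \<Rightarrow> None | x # _ \<Rightarrow> Some (Suc x))"
| "eval (Proj i) xs = (if i < length xs then Some (xs ! i) else None)"
| "eval (Comp f gs) xs = Option.bind (those (map (\<lambda>g. eval g xs) gs)) (eval f)"
| "eval (Prim f g) xs = (case xs of [] \<Rightarrow> None | n # ys \<Rightarrow>
     rec_nat (eval f ys) (\<lambda>m r. Option.bind r (\<lambda>v. eval g (m # v # ys))) n)"
| "eval (Mu f) xs =
     (if \<exists>n. eval f (n # xs) = Some 0 \<and> (\<forall>m<n. eval f (m # xs) \<noteq> None)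
      then Some (LEAST n. eval f (n # xs) = Some 0 \<and> (\<forall>m<n. eval f (m # xs) \<noteq> None))
      else None)"

definition recursive1 :: "(nat \<Rightarrow> nat option) \<Rightarrow> bool" where
  "recursive1 f \<longleftrightarrow> (\<exists>c. \<forall>x. f x = eval c [x])"

definition recursive2 :: "(nat \<Rightarrow> nat \<Rightarrow> nat option) \<Rightarrow> bool" where
  "recursive2 f \<longleftrightarrow> (\<exists>c. \<forall>x y. f x y = eval c [x, y])"

primrec code :: "recf \<Rightarrow> nat" where
  "code Zero = prod_encode (0, 0)"
| "code Succ = prod_encode (1, 0)"
| "code (Proj i) = prod_encode (2, i)"
| "code (Comp f gs) = prod_encode (3, prod_encode (code f, list_encode (map code gs)))"
| "code (Prim f g) = prod_encode (4, prod_encode (code f, code g))"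
| "code (Mu f) = prod_encode (5, code f)"

lemma code_inject: "code c = code d \<Longrightarrow> c = d"
proof (induction c arbitrary: d)
  case (Comp f gs)
  from Comp.prems obtain f' gs' where d: "d = Comp f' gs'"
    and ff: "code f = code f'" and gg: "map code gs = map code gs'"
    by (cases d) (auto simp: list_encode_eq)
  have "gs = gs'" using gg Comp.IH(2)
    by (metis (no_types, lifting) list.inj_map_strong)
  with ff Comp.IH(1) d show ?case by auto
next
  case Zero then show ?case by (cases d) auto
next
  case Succ then show ?case by (cases d) auto
next
  case (Proj i) then show ?case by (cases d) auto
next
  case (Prim f g) then show ?case by (cases d) auto
next
  case (Mu f) then show ?case by (cases d) auto
qed

text \<open>The RE set with index \<open>i\<close> is the domain of the unary function with code \<open>i\<close>; numbers that
  are not codes are indices of the empty set.\<close>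

definition W :: "nat \<Rightarrow> nat set" where
  "W i = {x. \<exists>c. code c = i \<and> eval c [x] \<noteq> None}"

definition RE :: "nat set \<Rightarrow> bool" where
  "RE A \<longleftrightarrow> (\<exists>i. A = W i)"


section \<open>First-order logic with equality in finite signatures\<close>

text \<open>The function symbols are the numbers below the length of \<open>fun_arities\<close>, whose entries are
  their arities; likewise for relation symbols. Constants are function symbols of arity 0.\<close>

datatype signature = Signature (fun_arities: "nat list") (rel_arities: "nat list")

text \<open>Variables are de Bruijn indices.\<close>

datatype tm = Var nat | Fun nat "tm list"

datatype fm = Bot | Eq tm tm | Rel nat "tm list" | Imp fm fm | All fm

definition Neg :: "fm \<Rightarrow> fm" where "Neg \<phi> = Imp \<phi> Bot"
definition Top :: fm where "Top = Neg Bot"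
definition And :: "fm \<Rightarrow> fm \<Rightarrow> fm" where "And \<phi> \<psi> = Neg (Imp \<phi> (Neg \<psi>))"
definition Or :: "fm \<Rightarrow> fm \<Rightarrow> fm" where "Or \<phi> \<psi> = Imp (Neg \<phi>) \<psi>"

fun wf_tm :: "signature \<Rightarrow> tm \<Rightarrow> bool" where
  "wf_tm L (Var n) \<longleftrightarrow> True"
| "wf_tm L (Fun f ts) \<longleftrightarrow> f < length (fun_arities L) \<and> length ts = fun_arities L ! f
     \<and> (\<forall>t \<in> set ts. wf_tm L t)"

fun wf_fm :: "signature \<Rightarrow> fm \<Rightarrow> bool" where
  "wf_fm L Bot \<longleftrightarrow> True"
| "wf_fm L (Eq s t) \<longleftrightarrow> wf_tm L s \<and> wf_tm L t"
| "wf_fm L (Rel r ts) \<longleftrightarrow> r < length (rel_arities L) \<and> length ts = rel_arities L ! r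
     \<and> (\<forall>t \<in> set ts. wf_tm L t)"
| "wf_fm L (Imp \<phi> \<psi>) \<longleftrightarrow> wf_fm L \<phi> \<and> wf_fm L \<psi>"
| "wf_fm L (All \<phi>) \<longleftrightarrow> wf_fm L \<phi>"

text \<open>All free indices are below \<open>k\<close>.\<close>

fun closed_tm :: "nat \<Rightarrow> tm \<Rightarrow> bool" where
  "closed_tm k (Var n) \<longleftrightarrow> n < k"
| "closed_tm k (Fun f ts) \<longleftrightarrow> (\<forall>t \<in> set ts. closed_tm k t)"

fun closed_fm :: "nat \<Rightarrow> fm \<Rightarrow> bool" where
  "closed_fm k Bot \<longleftrightarrow> True"
| "closed_fm k (Eq s t) \<longleftrightarrow> closed_tm k s \<and> closed_tm k t"
| "closed_fm k (Rel r ts) \<longleftrightarrow> (\<forall>t \<in> set ts. closed_tm k t)"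
| "closed_fm k (Imp \<phi> \<psi>) \<longleftrightarrow> closed_fm k \<phi> \<and> closed_fm k \<psi>"
| "closed_fm k (All \<phi>) \<longleftrightarrow> closed_fm (Suc k) \<phi>"

definition sentences :: "signature \<Rightarrow> fm set" where
  "sentences L = {\<phi>. wf_fm L \<phi> \<and> closed_fm 0 \<phi>}"

primrec subst_tm :: "(nat \<Rightarrow> tm) \<Rightarrow> tm \<Rightarrow> tm" where
  "subst_tm \<sigma> (Var n) = \<sigma> n"
| "subst_tm \<sigma> (Fun f ts) = Fun f (map (subst_tm \<sigma>) ts)"

primrec subst_fm :: "(nat \<Rightarrow> tm) \<Rightarrow> fm \<Rightarrow> fm" where
  "subst_fm \<sigma> Bot = Bot"
| "subst_fm \<sigma> (Eq s t) = Eq (subst_tm \<sigma> s) (subst_tm \<sigma> t)"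
| "subst_fm \<sigma> (Rel r ts) = Rel r (map (subst_tm \<sigma>) ts)"
| "subst_fm \<sigma> (Imp \<phi> \<psi>) = Imp (subst_fm \<sigma> \<phi>) (subst_fm \<sigma> \<psi>)"
| "subst_fm \<sigma> (All \<phi>) =
     All (subst_fm (case_nat (Var 0) (\<lambda>n. subst_tm (\<lambda>m. Var (Suc m)) (\<sigma> n))) \<phi>)"

definition lift_fm :: "fm \<Rightarrow> fm" where
  "lift_fm = subst_fm (\<lambda>n. Var (Suc n))"

text \<open>\<open>inst t \<phi>\<close> is the instance of \<open>All \<phi>\<close> at \<open>t\<close>.\<close>

definition inst :: "tm \<Rightarrow> fm \<Rightarrow> fm" where
  "inst t = subst_fm (case_nat t Var)"

text \<open>Classical natural deduction. In \<open>AllI\<close>, lifting the assumptions makes index 0 the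
  eigenvariable.\<close>

inductive proves :: "signature \<Rightarrow> fm set \<Rightarrow> fm \<Rightarrow> bool" for L :: signature where
  Assm: "\<phi> \<in> \<Gamma> \<Longrightarrow> wf_fm L \<phi> \<Longrightarrow> proves L \<Gamma> \<phi>"
| ImpI: "wf_fm L \<phi> \<Longrightarrow> proves L (insert \<phi> \<Gamma>) \<psi> \<Longrightarrow> proves L \<Gamma> (Imp \<phi> \<psi>)"
| ImpE: "proves L \<Gamma> (Imp \<phi> \<psi>) \<Longrightarrow> proves L \<Gamma> \<phi> \<Longrightarrow> proves L \<Gamma> \<psi>"
| Contr: "wf_fm L \<phi> \<Longrightarrow> proves L (insert (Neg \<phi>) \<Gamma>) Bot \<Longrightarrow> proves L \<Gamma> \<phi>"
| AllI: "proves L (lift_fm ` \<Gamma>) \<phi> \<Longrightarrow> proves L \<Gamma> (All \<phi>)"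
| AllE: "proves L \<Gamma> (All \<phi>) \<Longrightarrow> wf_tm L t \<Longrightarrow> proves L \<Gamma> (inst t \<phi>)"
| EqRefl: "wf_tm L t \<Longrightarrow> proves L \<Gamma> (Eq t t)"
| EqSubst: "wf_fm L \<phi> \<Longrightarrow> proves L \<Gamma> (Eq s t) \<Longrightarrow> proves L \<Gamma> (inst s \<phi>) \<Longrightarrow> proves L \<Gamma> (inst t \<phi>)"


section \<open>Goedel numbering\<close>

primrec gn_tm :: "tm \<Rightarrow> nat" where
  "gn_tm (Var n) = prod_encode (0, n)"
| "gn_tm (Fun f ts) = prod_encode (1, prod_encode (f, list_encode (map gn_tm ts)))"

primrec gn :: "fm \<Rightarrow> nat" where
  "gn Bot = prod_encode (0, 0)"
| "gn (Eq s t) = prod_encode (1, prod_encode (gn_tm s, gn_tm t))"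
| "gn (Rel r ts) = prod_encode (2, prod_encode (r, list_encode (map gn_tm ts)))"
| "gn (Imp \<phi> \<psi>) = prod_encode (3, prod_encode (gn \<phi>, gn \<psi>))"
| "gn (All \<phi>) = prod_encode (4, gn \<phi>)"

lemma gn_tm_inject: "gn_tm s = gn_tm t \<Longrightarrow> s = t"
proof (induction s arbitrary: t)
  case (Var n) then show ?case by (cases t) auto
next
  case (Fun f ts)
  from Fun.prems obtain ts' where t: "t = Fun f ts'" and "map gn_tm ts = map gn_tm ts'"
    by (cases t) (auto simp: list_encode_eq)
  then have "ts = ts'" using Fun.IH by (metis (no_types, lifting) list.inj_map_strong)
  with t show ?case by simp
qed

lemma gn_inject: "gn \<phi> = gn \<psi> \<Longrightarrow> \<phi> = \<psi>"
proof (induction \<phi> arbitrary: \<psi>)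
  case Bot then show ?case by (cases \<psi>) auto
next
  case (Eq s t) then show ?case by (cases \<psi>) (auto dest: gn_tm_inject)
next
  case (Rel r ts)
  have "inj gn_tm" by (auto intro: injI dest: gn_tm_inject)
  with Rel show ?case by (cases \<psi>) (auto simp: list_encode_eq inj_map_eq_map)
next
  case (Imp \<phi> \<phi>') then show ?case by (cases \<psi>) auto
next
  case (All \<phi>) then show ?case by (cases \<psi>) auto
qed


section \<open>Theories\<close>

text \<open>A theory is identified with its set of theorems.\<close>

definition is_theory :: "signature \<Rightarrow> fm set \<Rightarrow> bool" where
  "is_theory L T \<longleftrightarrow> T \<subseteq> sentences L \<and> (\<forall>\<phi> \<in> sentences L. proves L T \<phi> \<longrightarrow> \<phi> \<in> T)"

definition RE_theory :: "signature \<Rightarrow> fm set \<Rightarrow> bool" where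
  "RE_theory L T \<longleftrightarrow> is_theory L T \<and> RE (gn ` T)"

definition consistent :: "signature \<Rightarrow> fm set \<Rightarrow> bool" where
  "consistent L T \<longleftrightarrow> \<not> proves L T Bot"

definition provables :: "signature \<Rightarrow> fm set \<Rightarrow> fm set" where
  "provables L T = {\<phi> \<in> sentences L. proves L T \<phi>}"

definition refutables :: "signature \<Rightarrow> fm set \<Rightarrow> fm set" where
  "refutables L T = {\<phi> \<in> sentences L. proves L T (Neg \<phi>)}"

definition EI_pair :: "nat set \<Rightarrow> nat set \<Rightarrow> bool" where
  "EI_pair A B \<longleftrightarrow> RE A \<and> RE B \<and> A \<inter> B = {} \<and>
     (\<exists>f. recursive2 f \<and>
       (\<forall>i j. A \<subseteq> W i \<and> B \<subseteq> W j \<and> W i \<inter> W j = {} \<longrightarrow>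
         (\<exists>n. f i j = Some n \<and> n \<notin> W i \<union> W j)))"

definition EI :: "signature \<Rightarrow> fm set \<Rightarrow> bool" where
  "EI L T \<longleftrightarrow> EI_pair (gn ` provables L T) (gn ` refutables L T)"

definition is_filter :: "signature \<Rightarrow> fm set \<Rightarrow> bool" where
  "is_filter L X \<longleftrightarrow> X \<subseteq> sentences L \<and>
     (\<forall>\<alpha> \<in> sentences L. \<forall>\<beta> \<in> sentences L. \<alpha> \<in> X \<and> proves L {\<alpha>} \<beta> \<longrightarrow> \<beta> \<in> X) \<and>
     (\<forall>\<alpha> \<beta>. \<alpha> \<in> X \<and> \<beta> \<in> X \<longrightarrow> And \<alpha> \<beta> \<in> X) \<and>
     Bot \<notin> X"

definition is_ideal :: "signature \<Rightarrow> fm set \<Rightarrow> bool" where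
  "is_ideal L Y \<longleftrightarrow> Y \<subseteq> sentences L \<and>
     (\<forall>\<alpha> \<in> sentences L. \<forall>\<beta> \<in> sentences L. \<alpha> \<in> Y \<and> proves L {\<beta>} \<alpha> \<longrightarrow> \<beta> \<in> Y) \<and>
     (\<forall>\<alpha> \<beta>. \<alpha> \<in> Y \<and> \<beta> \<in> Y \<longrightarrow> Or \<alpha> \<beta> \<in> Y) \<and>
     Top \<notin> Y"

definition tEI :: "signature \<Rightarrow> fm set \<Rightarrow> bool" where
  "tEI L T \<longleftrightarrow>
     (\<exists>f. recursive2 f \<and>
       (\<forall>i j X Y. is_filter L X \<and> gn ` X = W i \<and> is_ideal L Y \<and> gn ` Y = W j \<and>
           provables L T \<subseteq> X \<and> refutables L T \<subseteq> Y \<and> X \<inter> Y = {} \<longrightarrow>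
         (\<exists>\<phi> \<in> sentences L. f i j = Some (gn \<phi>) \<and> \<phi> \<notin> X \<union> Y)))"

definition EET :: "signature \<Rightarrow> fm set \<Rightarrow> bool" where
  "EET L T \<longleftrightarrow>
     (\<exists>f. recursive1 f \<and>
       (\<forall>i S. is_theory L S \<and> consistent L S \<and> T \<subseteq> S \<and> gn ` S = W i \<longrightarrow>
         (\<exists>\<phi> \<in> sentences L. f i = Some (gn \<phi>) \<and> \<not> proves L S \<phi> \<and> \<not> proves L S (Neg \<phi>))))"

end

theory Submission
  imports Defs
begin

text \<open>\<open>EI \<Longrightarrow> tEI\<close>: add the non-sentences, which form an RE set, to the filter, so that the separating function
  has to output a sentence. \<open>tEI \<Longrightarrow> EET\<close>: the theorems and the refutable sentences of a consistent
  extension are a disjoint filter and ideal. \<open>EET \<Longrightarrow> EI\<close>: let \<open>f\<close> be the extension function, and let \<open>W i\<close>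
  and \<open>W j\<close> be disjoint supersets of the theorems and the refutable sentences. By the recursion theorem
  there is an index \<open>e\<close>, computable from \<open>i\<close> and \<open>j\<close>, of the theory that is \<open>T\<close> together with \<open>f(e)\<close>
  if \<open>f(e)\<close> lies in \<open>W i\<close>, and \<open>T\<close> together with the negation of \<open>f(e)\<close> if it lies in \<open>W j\<close>. In both cases
  this theory would be consistent and decide \<open>f(e)\<close>, so \<open>f(e)\<close> lies in neither set.\<close>

section \<open>Total computable functions\<close>

text \<open>Derivations are never arithmetised. A theory is a deductively closed set, so adding
  \<open>\<phi>\<close> yields \<open>{\<psi>. Imp \<phi> \<psi> \<in> T}\<close>, which inherits
  enumerability from \<open>T\<close> through the pairing that codes implications. Computability, in
  contrast, has to be built up: \<open>eval\<close> is a semantic function without a notion of step,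
  so universality comes from finite certificates for evaluation facts. Such facts can also hold for
  numbers that are not program codes, although their \<open>W\<close> is empty. Each implication
  therefore checks that the index sets it enumerates are nonempty; they contain theorems or
  refutable sentences. In the last implication convergence of \<open>f(e)\<close> is not given in
  advance, since \<open>f\<close> is specified only at indices of consistent extensions. The set
  with index \<open>e\<close> is therefore \<open>T\<close> itself as long as \<open>f(e)\<close> is
  undefined or lies in neither set, and the specification of \<open>f\<close> at an index of
  \<open>T\<close> supplies the value.\<close>

abbreviation pair :: "nat \<Rightarrow> nat \<Rightarrow> nat" where "pair a b \<equiv> prod_encode (a, b)"
abbreviation pfst :: "nat \<Rightarrow> nat" where "pfst z \<equiv> fst (prod_decode z)"
abbreviation psnd :: "nat \<Rightarrow> nat" where "psnd z \<equiv> snd (prod_decode z)"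

text \<open>Only unary functions are considered; several arguments are passed as one nested pair. A
  bound variable then becomes a component of the argument, so that the rules for bounded
  quantifiers and recursion below can be applied by higher-order unification.\<close>

definition computable :: "(nat \<Rightarrow> nat) \<Rightarrow> bool" where
  "computable f \<longleftrightarrow> (\<exists>c. \<forall>x. eval c [x] = Some (f x))"

definition computable2 :: "(nat \<Rightarrow> nat \<Rightarrow> nat) \<Rightarrow> bool" where
  "computable2 f \<longleftrightarrow> (\<exists>c. \<forall>x y. eval c [x, y] = Some (f x y))"

lemma computable_id: "computable (\<lambda>x. x)"
  unfolding computable_def by (rule exI[of _ "Proj 0"]) simp

lemma computable_comp: "computable f \<Longrightarrow> computable g \<Longrightarrow> computable (\<lambda>x. f (g x))"
proof -
  assume "computable f" "computable g"
  then obtain c d where "\<And>x. eval c [x] = Some (f x)" "\<And>x. eval d [x] = Some (g x)"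
    unfolding computable_def by blast
  then have "eval (Comp c [d]) [x] = Some (f (g x))" for x by simp
  then show ?thesis unfolding computable_def by blast
qed

lemma computable2_comp:
  assumes "computable2 f" "computable g" "computable h"
  shows "computable (\<lambda>x. f (g x) (h x))"
proof -
  from assms obtain c d e where "\<And>x y. eval c [x, y] = Some (f x y)"
    "\<And>x. eval d [x] = Some (g x)" "\<And>x. eval e [x] = Some (h x)"
    unfolding computable_def computable2_def by blast
  then have "eval (Comp c [d, e]) [x] = Some (f (g x) (h x))" for x by simp
  then show ?thesis unfolding computable_def by blast
qed

lemma computable_Suc_id: "computable Suc"
  unfolding computable_def by (rule exI[of _ Succ]) simp

lemmas computable_Suc = computable_comp[OF computable_Suc_id]

primrec const_prog :: "nat \<Rightarrow> recf" where
  "const_prog 0 = Zero"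
| "const_prog (Suc n) = Comp Succ [const_prog n]"

lemma eval_const_prog [simp]: "eval (const_prog n) xs = Some n"
  by (induction n) auto

lemma computable_const: "computable (\<lambda>_. n)"
  unfolding computable_def by (rule exI[of _ "const_prog n"]) simp

section \<open>Programs for arithmetic and the Cantor pairing\<close>

definition add_prog :: recf where "add_prog = Prim (Proj 0) (Comp Succ [Proj 1])"
definition pred_prog :: recf where "pred_prog = Prim Zero (Proj 0)"
text \<open>Primitive recursion runs over the first argument, so the subtrahend stands first: the
  value at \<open>[a, b]\<close> is \<open>b - a\<close>.\<close>

definition monus_prog :: recf where "monus_prog = Prim (Proj 0) (Comp pred_prog [Proj 1])"
definition triangle_prog :: recf where
  "triangle_prog = Prim Zero (Comp add_prog [Proj 1, Comp Succ [Proj 0]])"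
definition pair_prog :: recf where
  "pair_prog = Comp add_prog [Comp triangle_prog [add_prog], Proj 0]"

lemma eval_add_prog [simp]: "eval add_prog [a, b] = Some (a + b)"
  by (induction a) (auto simp: add_prog_def)

lemma eval_pred_prog [simp]: "eval pred_prog [a] = Some (a - 1)"
  by (induction a) (auto simp: pred_prog_def)

lemma eval_monus_prog [simp]: "eval monus_prog [a, b] = Some (b - a)"
  by (induction a) (auto simp: monus_prog_def)

lemma eval_triangle_prog [simp]: "eval triangle_prog [a] = Some (triangle a)"
  by (induction a) (auto simp: triangle_prog_def)

lemma eval_pair_prog [simp]: "eval pair_prog [a, b] = Some (pair a b)"
  by (simp add: pair_prog_def prod_encode_def)

lemma computable2_add: "computable2 (+)"
  unfolding computable2_def by (rule exI[of _ add_prog]) simp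

lemma computable2_diff: "computable2 (\<lambda>x y. x - y)"
  unfolding computable2_def by (rule exI[of _ "Comp monus_prog [Proj 1, Proj 0]"]) simp

lemma computable2_pair: "computable2 pair"
  unfolding computable2_def by (rule exI[of _ pair_prog]) simp

lemmas computable_add = computable2_comp[OF computable2_add]
lemmas computable_diff = computable2_comp[OF computable2_diff]
lemmas computable_pair = computable2_comp[OF computable2_pair]

lemma computable_triangle: "computable triangle"
  unfolding computable_def by (rule exI[of _ triangle_prog]) simp

lemma eval_Mu_total:
  assumes "\<And>n. eval c (n # xs) = Some (f n)"
  shows "eval (Mu c) xs = (if \<exists>n. f n = 0 then Some (LEAST n. f n = 0) else None)"
  using assms by simp

lemma computable_Least2:
  assumes "computable2 f" "\<And>x. \<exists>n. f n x = 0"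
  shows "computable (\<lambda>x. LEAST n. f n x = 0)"
proof -
  from assms obtain c where "\<And>x y. eval c [x, y] = Some (f x y)"
    unfolding computable2_def by blast
  then have "eval (Mu c) [x] = Some (LEAST n. f n x = 0)" for x
    using eval_Mu_total[of c "[x]" "\<lambda>n. f n x"] assms(2) by simp
  then show ?thesis unfolding computable_def by blast
qed

lemma triangle_mono: "m \<le> n \<Longrightarrow> triangle m \<le> triangle n"
  by (induction n rule: dec_induct) auto

text \<open>A pair is \<open>triangle (a + b) + a\<close>, so \<open>a + b\<close> is the least
  \<open>w\<close> for which \<open>triangle (Suc w)\<close> exceeds the code. The condition is a
  vanishing difference because \<open>Mu\<close> searches for zeros.\<close>

lemma triangle_root: "(LEAST w. Suc (pair a b) - triangle (Suc w) = 0) = a + b"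
proof (rule Least_equality)
  show "Suc (pair a b) - triangle (Suc (a + b)) = 0"
    by (simp add: prod_encode_def)
  fix w
  assume "Suc (pair a b) - triangle (Suc w) = 0"
  then show "a + b \<le> w"
    using triangle_mono[of "Suc w" "a + b"]
    by (cases "a + b \<le> w") (auto simp: prod_encode_def simp del: triangle_Suc)
qed

lemma computable_prod_decode:
  shows computable_pfst_id: "computable pfst" and computable_psnd_id: "computable psnd"
proof -
  define root where "root z = (LEAST w. Suc z - triangle (Suc w) = 0)" for z
  have root: "root (pair a b) = a + b" for a b
    unfolding root_def by (rule triangle_root)
  have "computable root"
    unfolding root_def
  proof (rule computable_Least2)
    have "eval (Comp monus_prog [Comp triangle_prog [Comp Succ [Proj 0]], Comp Succ [Proj 1]]) [w, z]
      = Some (Suc z - triangle (Suc w))" for w z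
      by simp
    then show "computable2 (\<lambda>w z. Suc z - triangle (Suc w))"
      unfolding computable2_def by blast
    show "\<exists>w. Suc z - triangle (Suc w) = 0" for z
      by (rule exI[of _ z]) simp
  qed
  have eq: "pfst z = z - triangle (root z)" "psnd z = root z - (z - triangle (root z))" for z
  proof -
    obtain a b where z: "z = pair a b" by (metis prod.exhaust prod_decode_inverse)
    have "z = triangle (a + b) + a" by (simp add: z prod_encode_def)
    moreover have "root z = a + b" by (simp add: z root)
    moreover have "pfst z = a" "psnd z = b" by (simp_all add: z)
    ultimately show "pfst z = z - triangle (root z)" "psnd z = root z - (z - triangle (root z))"
      by simp_all
  qed
  show "computable pfst" "computable psnd"
    unfolding eq
    by (intro computable_diff computable_id computable_comp[OF computable_triangle] \<open>computable root\<close>)+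
qed

lemmas computable_pfst = computable_comp[OF computable_pfst_id]
lemmas computable_psnd = computable_comp[OF computable_psnd_id]

lemma computable_rec_nat:
  assumes "computable a" "computable (\<lambda>z. s (pfst z) (pfst (psnd z)) (psnd (psnd z)))"
    and "computable b"
  shows "computable (\<lambda>x. rec_nat (a x) (\<lambda>m r. s m r x) (b x))"
proof -
  from assms obtain ca cs cb where c: "\<And>x. eval ca [x] = Some (a x)"
    "\<And>z. eval cs [z] = Some (s (pfst z) (pfst (psnd z)) (psnd (psnd z)))"
    "\<And>x. eval cb [x] = Some (b x)"
    unfolding computable_def by blast
  let ?p = "Prim ca (Comp cs [Comp pair_prog [Proj 0, Comp pair_prog [Proj 1, Proj 2]]])"
  have "eval ?p [n, x] = Some (rec_nat (a x) (\<lambda>m r. s m r x) n)" for n x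
    by (induction n) (simp_all add: c)
  then have "eval (Comp ?p [cb, Proj 0]) [x] = Some (rec_nat (a x) (\<lambda>m r. s m r x) (b x))" for x
    by (simp add: c)
  then show ?thesis unfolding computable_def by blast
qed

lemmas computable_basic = computable_id computable_const computable_Suc computable_add
  computable_diff computable_pair computable_pfst computable_psnd computable_rec_nat

section \<open>Decidable predicates\<close>

definition decidable :: "(nat \<Rightarrow> bool) \<Rightarrow> bool" where
  "decidable P \<longleftrightarrow> computable (\<lambda>x. of_bool (P x))"

lemma decidable_comp: "decidable P \<Longrightarrow> computable f \<Longrightarrow> decidable (\<lambda>x. P (f x))"
  unfolding decidable_def by (rule computable_comp)

text \<open>A recursion of length \<open>of_bool (P x)\<close> selects the branch: no step leaves
  \<open>g x\<close>, one step replaces it by \<open>f x\<close>.\<close>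

lemma computable_if:
  assumes "decidable P" "computable f" "computable g"
  shows "computable (\<lambda>x. if P x then f x else g x)"
proof -
  have "(\<lambda>x. if P x then f x else g x) = (\<lambda>x. rec_nat (g x) (\<lambda>_ _. f x) (of_bool (P x)))"
    by auto
  moreover have "computable (\<lambda>x. rec_nat (g x) (\<lambda>_ _. f x) (of_bool (P x)))"
    by (intro computable_basic computable_comp[OF assms(2)] assms(3) assms(1)[unfolded decidable_def])
  ultimately show ?thesis by simp
qed

lemma decidable_const: "decidable (\<lambda>_. P)"
  unfolding decidable_def by (rule computable_const)

lemma decidable_not: "decidable P \<Longrightarrow> decidable (\<lambda>x. \<not> P x)"
proof -
  assume "decidable P"
  then have "computable (\<lambda>x. 1 - of_bool (P x))"
    unfolding decidable_def by (intro computable_basic)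
  moreover have "(\<lambda>x. 1 - of_bool (P x)) = (\<lambda>x. of_bool (\<not> P x) :: nat)" by auto
  ultimately show ?thesis unfolding decidable_def by simp
qed

lemma decidable_conj:
  assumes "decidable P" "decidable Q"
  shows "decidable (\<lambda>x. P x \<and> Q x)"
proof -
  have "computable (\<lambda>x. if P x then of_bool (Q x) else 0)"
    using assms by (intro computable_if computable_const) (simp_all add: decidable_def)
  moreover have "(\<lambda>x. if P x then of_bool (Q x) else 0) = (\<lambda>x. of_bool (P x \<and> Q x) :: nat)" by auto
  ultimately show ?thesis unfolding decidable_def by simp
qed

lemma decidable_disj: "decidable P \<Longrightarrow> decidable Q \<Longrightarrow> decidable (\<lambda>x. P x \<or> Q x)"
  using decidable_not[OF decidable_conj[OF decidable_not[of P] decidable_not[of Q]]] by simp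

lemma decidable_less:
  assumes "computable f" "computable g"
  shows "decidable (\<lambda>x. f x < g x)"
proof -
  \<comment> \<open>With truncated subtraction, \<open>1 - (1 - d)\<close> is the sign of
    \<open>d\<close>.\<close>
  have "computable (\<lambda>x. 1 - (1 - (g x - f x)))"
    using assms by (intro computable_basic)
  moreover have "(\<lambda>x. 1 - (1 - (g x - f x))) = (\<lambda>x. of_bool (f x < g x))"
    by (auto simp: fun_eq_iff)
  ultimately show ?thesis unfolding decidable_def by simp
qed

lemma decidable_le: "computable f \<Longrightarrow> computable g \<Longrightarrow> decidable (\<lambda>x. f x \<le> g x)"
  using decidable_not[OF decidable_less[of g f]] by (simp add: not_less)

lemma decidable_eq: "computable f \<Longrightarrow> computable g \<Longrightarrow> decidable (\<lambda>x. f x = g x)"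
  unfolding order_eq_iff by (intro decidable_conj decidable_le)

lemma decidable_bex_less:
  assumes P: "decidable (\<lambda>z. P (pfst z) (psnd z))" and "computable b"
  shows "decidable (\<lambda>x. \<exists>y<b x. P y x)"
proof -
  let ?F = "\<lambda>x. rec_nat (0::nat) (\<lambda>m r. if P m x then 1 else r)"
  have "decidable (\<lambda>z. P (pfst z) (psnd (psnd z)))"
    using decidable_comp[OF P, of "\<lambda>z. pair (pfst z) (psnd (psnd z))"]
    by (simp add: computable_basic)
  then have "computable (\<lambda>x. ?F x (b x))"
    by (intro computable_basic computable_if assms(2))
  moreover have "?F x n = of_bool (\<exists>y<n. P y x)" for n x
    by (induction n) (auto simp: less_Suc_eq)
  ultimately show ?thesis unfolding decidable_def by (simp only:)
qed

lemma decidable_ball_less: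
  assumes "decidable (\<lambda>z. P (pfst z) (psnd z))" "computable b"
  shows "decidable (\<lambda>x. \<forall>y<b x. P y x)"
  using decidable_not[OF decidable_bex_less[OF decidable_not[OF assms(1)] assms(2)]] by simp

lemma computable_Least:
  assumes P: "decidable (\<lambda>z. P (pfst z) (psnd z))" and ex: "\<And>x. \<exists>y. P y x"
  shows "computable (\<lambda>x. LEAST y. P y x)"
proof -
  from decidable_not[OF P] obtain c
    where c: "\<And>z. eval c [z] = Some (of_bool (\<not> P (pfst z) (psnd z)))"
    unfolding decidable_def computable_def by blast
  have "eval (Comp c [pair_prog]) [x, y] = Some (of_bool (\<not> P x y))" for x y
    by (simp add: c)
  then have "computable2 (\<lambda>x y. of_bool (\<not> P x y))"
    unfolding computable2_def by blast
  from computable_Least2[OF this] ex show ?thesis by simp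
qed

lemmas decidable_intros = decidable_const decidable_not decidable_conj decidable_disj
  decidable_less decidable_le decidable_eq decidable_bex_less decidable_ball_less

section \<open>Lists\<close>

text \<open>These operations invert \<open>list_encode\<close> arithmetically: 0 is the empty list,
  a nonempty list is \<open>Suc\<close> of a pair. The tail of 0 is 0, so dropping past the end
  stays at 0 and the length is the first \<open>k\<close> at which 0 is reached.\<close>

definition list_hd :: "nat \<Rightarrow> nat" where "list_hd t = pfst (t - 1)"
definition list_tl :: "nat \<Rightarrow> nat" where "list_tl t = psnd (t - 1)"
abbreviation list_cons :: "nat \<Rightarrow> nat \<Rightarrow> nat" where "list_cons x t \<equiv> Suc (pair x t)"
definition list_drop :: "nat \<Rightarrow> nat \<Rightarrow> nat" where "list_drop t k = rec_nat t (\<lambda>_ r. list_tl r) k"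
definition list_nth :: "nat \<Rightarrow> nat \<Rightarrow> nat" where "list_nth t k = list_hd (list_drop t k)"
definition list_len :: "nat \<Rightarrow> nat" where "list_len t = (LEAST k. list_drop t k = 0)"

lemma list_hd_cons [simp]: "list_hd (list_cons x t) = x"
  and list_tl_cons [simp]: "list_tl (list_cons x t) = t"
  by (simp_all add: list_hd_def list_tl_def)

lemma list_tl_encode: "list_tl (list_encode xs) = list_encode (tl xs)"
proof (cases xs)
  case Nil
  have "prod_decode 0 = (0, 0)"
    using prod_encode_inverse[of "(0, 0)"] by (simp add: prod_encode_def)
  with Nil show ?thesis by (simp add: list_tl_def)
qed simp

lemma list_drop_encode [simp]: "list_drop (list_encode xs) k = list_encode (drop k xs)"
  by (induction k) (auto simp: list_drop_def list_tl_encode drop_Suc tl_drop)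

lemma list_encode_eq_0 [simp]: "list_encode xs = 0 \<longleftrightarrow> xs = []"
  by (cases xs) auto

lemma list_nth_encode [simp]: "k < length xs \<Longrightarrow> list_nth (list_encode xs) k = xs ! k"
  by (metis Cons_nth_drop_Suc list_drop_encode list_encode.simps(2) list_hd_cons list_nth_def)

lemma list_len_encode [simp]: "list_len (list_encode xs) = length xs"
  unfolding list_len_def by (rule Least_equality) auto

lemma computable_list_hd: "computable f \<Longrightarrow> computable (\<lambda>x. list_hd (f x))"
  and computable_list_tl: "computable f \<Longrightarrow> computable (\<lambda>x. list_tl (f x))"
  unfolding list_hd_def list_tl_def by (intro computable_basic; assumption)+

lemma computable_list_drop:
  "computable f \<Longrightarrow> computable g \<Longrightarrow> computable (\<lambda>x. list_drop (f x) (g x))"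
  unfolding list_drop_def by (intro computable_basic computable_list_tl)

lemma computable_list_nth:
  "computable f \<Longrightarrow> computable g \<Longrightarrow> computable (\<lambda>x. list_nth (f x) (g x))"
  unfolding list_nth_def by (intro computable_list_hd computable_list_drop)

lemma computable_list_len: "computable f \<Longrightarrow> computable (\<lambda>x. list_len (f x))"
proof (rule computable_comp[of list_len])
  have "\<exists>k. list_drop x k = 0" for x
    by (metis drop_all list_decode_inverse list_drop_encode list_encode.simps(1) order_refl)
  then show "computable list_len"
    unfolding list_len_def
    by (intro computable_Least decidable_intros computable_list_drop computable_basic)
qed

text \<open>The quantifier over members becomes a bounded quantifier over positions. Every number
  codes a list, so only computability is asked of \<open>f\<close>.\<close>

lemma decidable_bex_list:
  assumes P: "decidable (\<lambda>z. P (pfst z) (psnd z))" and f: "computable f"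
  shows "decidable (\<lambda>x. \<exists>y\<in>set (list_decode (f x)). P y x)"
proof -
  have "(\<exists>y\<in>set (list_decode (f x)). P y x) \<longleftrightarrow> (\<exists>k<list_len (f x). P (list_nth (f x) k) x)" for x
  proof -
    define ys where "ys = list_decode (f x)"
    then have "f x = list_encode ys" by simp
    then show ?thesis by (metis in_set_conv_nth list_decode_inverse list_encode_inverse list_len_encode list_nth_encode)
  qed
  moreover have "decidable (\<lambda>x. \<exists>k<list_len (f x). P (list_nth (f x) k) x)"
  proof (rule decidable_bex_less)
    show "decidable (\<lambda>z. P (list_nth (f (psnd z)) (pfst z)) (psnd z))"
      using decidable_comp[OF P, of "\<lambda>z. pair (list_nth (f (psnd z)) (pfst z)) (psnd z)"]
      by (simp add: computable_basic computable_list_nth computable_comp[OF f])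
  qed (intro computable_list_len f)
  ultimately show ?thesis by simp
qed

lemma decidable_ball_list:
  assumes "decidable (\<lambda>z. P (pfst z) (psnd z))" "computable f"
  shows "decidable (\<lambda>x. \<forall>y\<in>set (list_decode (f x)). P y x)"
  using decidable_not[OF decidable_bex_list[OF decidable_not[OF assms(1)] assms(2)]] by simp

lemma decidable_in_list:
  assumes "computable f" "computable g"
  shows "decidable (\<lambda>x. g x \<in> set (list_decode (f x)))"
proof -
  have "decidable (\<lambda>x. \<exists>y\<in>set (list_decode (f x)). y = g x)"
    by (intro decidable_bex_list decidable_eq computable_basic assms computable_comp[OF assms(2)])
  then show ?thesis by simp
qed

lemmas computable_intros = computable_basic computable_if computable_list_hd computable_list_tl
  computable_list_nth computable_list_len
  decidable_intros decidable_bex_list decidable_ball_list decidable_in_list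

section \<open>Semidecidable predicates\<close>

text \<open>The projection form of enumerability: closure under conjunction, disjunction and
  existential quantification is mere recoding of the witness \<open>t\<close>. Agreement with
  domains of programs is proved once, in \<open>RE_iff_semidecidable\<close>.\<close>

definition semidecidable :: "(nat \<Rightarrow> bool) \<Rightarrow> bool" where
  "semidecidable P \<longleftrightarrow>
     (\<exists>Q. decidable (\<lambda>z. Q (pfst z) (psnd z)) \<and> (\<forall>x. P x \<longleftrightarrow> (\<exists>t. Q t x)))"

lemma semidecidableI:
  "decidable (\<lambda>z. Q (pfst z) (psnd z)) \<Longrightarrow> (\<And>x. P x \<longleftrightarrow> (\<exists>t. Q t x)) \<Longrightarrow> semidecidable P"
  unfolding semidecidable_def by blast

text \<open>\<open>Q\<close> is handed out with arbitrary computable arguments instead of the two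
  halves of a pair, so that the goals of the closure lemmas are solved by introduction
  rules.\<close>

lemma semidecidableE:
  assumes "semidecidable P"
  obtains Q where "\<And>f g. computable f \<Longrightarrow> computable g \<Longrightarrow> decidable (\<lambda>x. Q (f x) (g x))"
    "\<And>x. P x \<longleftrightarrow> (\<exists>t. Q t x)"
proof -
  from assms obtain Q where Q: "decidable (\<lambda>z. Q (pfst z) (psnd z))" "\<And>x. P x \<longleftrightarrow> (\<exists>t. Q t x)"
    unfolding semidecidable_def by blast
  have "decidable (\<lambda>x. Q (f x) (g x))" if "computable f" "computable g" for f g
    using decidable_comp[OF Q(1) computable_pair[OF that]] by simp
  with Q(2) that show thesis by blast
qed

lemma semidecidable_comp: "semidecidable P \<Longrightarrow> computable f \<Longrightarrow> semidecidable (\<lambda>x. P (f x))"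
proof (erule semidecidableE)
  fix Q
  assume f: "computable f" and P: "\<And>x. P x \<longleftrightarrow> (\<exists>t. Q t x)"
    and Q: "\<And>f g. computable f \<Longrightarrow> computable g \<Longrightarrow> decidable (\<lambda>x. Q (f x) (g x))"
  show "semidecidable (\<lambda>x. P (f x))"
    by (rule semidecidableI[of "\<lambda>t x. Q t (f x)"])
      (auto intro!: Q computable_intros computable_comp[OF f] simp: P)
qed

lemma decidable_imp_semidecidable: "decidable P \<Longrightarrow> semidecidable P"
  by (rule semidecidableI[of "\<lambda>_. P"], rule decidable_comp) (auto intro: computable_intros)

lemma semidecidable_conj:
  assumes "semidecidable P1" "semidecidable P2"
  shows "semidecidable (\<lambda>x. P1 x \<and> P2 x)"
proof -
  obtain Q1
    where Q1: "\<And>f g. computable f \<Longrightarrow> computable g \<Longrightarrow> decidable (\<lambda>x. Q1 (f x) (g x))"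
      "\<And>x. P1 x \<longleftrightarrow> (\<exists>t. Q1 t x)"
    by (rule semidecidableE[OF assms(1)]) (rule that)
  obtain Q2
    where Q2: "\<And>f g. computable f \<Longrightarrow> computable g \<Longrightarrow> decidable (\<lambda>x. Q2 (f x) (g x))"
      "\<And>x. P2 x \<longleftrightarrow> (\<exists>t. Q2 t x)"
    by (rule semidecidableE[OF assms(2)]) (rule that)
  show ?thesis
  proof (rule semidecidableI[of "\<lambda>t x. Q1 (pfst t) x \<and> Q2 (psnd t) x"])
    fix x
    have "Q1 t x \<Longrightarrow> Q2 u x \<Longrightarrow> Q1 (pfst (pair t u)) x \<and> Q2 (psnd (pair t u)) x" for t u
      by simp
    then show "P1 x \<and> P2 x \<longleftrightarrow> (\<exists>t. Q1 (pfst t) x \<and> Q2 (psnd t) x)"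
      unfolding Q1(2) Q2(2) by blast
  qed (intro Q1(1) Q2(1) computable_intros)
qed

lemma semidecidable_disj:
  assumes "semidecidable P1" "semidecidable P2"
  shows "semidecidable (\<lambda>x. P1 x \<or> P2 x)"
proof -
  obtain Q1
    where Q1: "\<And>f g. computable f \<Longrightarrow> computable g \<Longrightarrow> decidable (\<lambda>x. Q1 (f x) (g x))"
      "\<And>x. P1 x \<longleftrightarrow> (\<exists>t. Q1 t x)"
    by (rule semidecidableE[OF assms(1)]) (rule that)
  obtain Q2
    where Q2: "\<And>f g. computable f \<Longrightarrow> computable g \<Longrightarrow> decidable (\<lambda>x. Q2 (f x) (g x))"
      "\<And>x. P2 x \<longleftrightarrow> (\<exists>t. Q2 t x)"
    by (rule semidecidableE[OF assms(2)]) (rule that)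
  show ?thesis
    by (rule semidecidableI[of "\<lambda>t x. Q1 t x \<or> Q2 t x"])
      (auto intro!: Q1(1) Q2(1) computable_intros simp: Q1(2) Q2(2))
qed

lemma semidecidable_ex:
  assumes "semidecidable (\<lambda>z. P (pfst z) (psnd z))"
  shows "semidecidable (\<lambda>x. \<exists>n. P n x)"
proof -
  obtain Q
    where Q: "\<And>f g. computable f \<Longrightarrow> computable g \<Longrightarrow> decidable (\<lambda>x. Q (f x) (g x))"
      and P: "\<And>z. P (pfst z) (psnd z) \<longleftrightarrow> (\<exists>t. Q t z)"
    by (rule semidecidableE[OF assms]) (rule that)
  show ?thesis
  proof (rule semidecidableI[of "\<lambda>t x. Q (psnd t) (pair (pfst t) x)"])
    fix x
    have "P n x \<longleftrightarrow> (\<exists>t. Q t (pair n x))" for n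
      using P[of "pair n x"] by simp
    moreover have "(\<exists>n t. Q t (pair n x)) \<longleftrightarrow> (\<exists>t. Q (psnd t) (pair (pfst t) x))"
      by (metis fst_conv snd_conv prod_encode_inverse)
    ultimately show "(\<exists>n. P n x) \<longleftrightarrow> (\<exists>t. Q (psnd t) (pair (pfst t) x))"
      by blast
  qed (intro Q(1) computable_intros)
qed

text \<open>Both the evaluation relation and the non-sentences are generated by rules that pass from finitely
  many facts to a further one. Such a set is semidecidable, because a fact belongs to it if and only if it
  occurs in a finite list of facts each of which is justified by the members of the list. The
  justification may be circular; in the two applications structural induction rules this out.\<close>

definition certified :: "(nat set \<Rightarrow> nat \<Rightarrow> bool) \<Rightarrow> nat set" where
  "certified J = \<Union>{X. finite X \<and> (\<forall>p\<in>X. J X p)}"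

lemma semidecidable_certified:
  assumes "\<And>f g. computable f \<Longrightarrow> computable g \<Longrightarrow> decidable (\<lambda>x. J (set (list_decode (f x))) (g x))"
  shows "semidecidable (\<lambda>p. p \<in> certified J)"
proof (rule semidecidableI[of "\<lambda>t p. p \<in> set (list_decode t) \<and>
      (\<forall>q\<in>set (list_decode t). J (set (list_decode t)) q)"])
  fix p
  have "(\<exists>X. p \<in> X \<and> finite X \<and> (\<forall>q\<in>X. J X q)) \<longleftrightarrow>
      (\<exists>t. p \<in> set (list_decode t) \<and> (\<forall>q\<in>set (list_decode t). J (set (list_decode t)) q))"
    by (metis finite_list finite_set list_encode_inverse)
  then show "p \<in> certified J \<longleftrightarrow>
      (\<exists>t. p \<in> set (list_decode t) \<and> (\<forall>q\<in>set (list_decode t). J (set (list_decode t)) q))"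
    unfolding certified_def by blast
qed (intro assms computable_intros)

lemma certified_unfold:
  assumes "mono J" "p \<in> certified J"
  shows "J (certified J) p"
proof -
  from assms(2) obtain X where X: "p \<in> X" "finite X" "\<forall>q\<in>X. J X q"
    unfolding certified_def by blast
  then have "X \<subseteq> certified J" unfolding certified_def by blast
  with X monoD[OF assms(1)] show ?thesis by blast
qed

text \<open>Certificates can be merged: by monotonicity a fact justified in one of them stays
  justified in the union. The certificates of the members of \<open>Y\<close>, with \<open>p\<close>
  added, thus certify \<open>p\<close>.\<close>

lemma certifiedI:
  assumes mono: "mono J"
    and Y: "finite Y" "Y \<subseteq> certified J" "J Y p"
  shows "p \<in> certified J"
proof -
  from Y(2) have "\<forall>y\<in>Y. \<exists>X. y \<in> X \<and> finite X \<and> (\<forall>q\<in>X. J X q)"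
    unfolding certified_def by blast
  then obtain F where F: "\<And>y. y \<in> Y \<Longrightarrow> y \<in> F y \<and> finite (F y) \<and> (\<forall>q\<in>F y. J (F y) q)"
    by metis
  let ?X = "insert p (\<Union>(F ` Y))"
  have "J ?X q" if "q \<in> ?X" for q
    using that
  proof (elim insertE UN_E)
    assume "q = p"
    with Y(3) F monoD[OF mono, of Y ?X] show ?thesis by blast
  next
    fix y assume "y \<in> Y" "q \<in> F y"
    with F monoD[OF mono, of "F y" ?X] show ?thesis by blast
  qed
  moreover have "finite ?X" using Y(1) F by blast
  ultimately show ?thesis unfolding certified_def by blast
qed

section \<open>The universal evaluation relation\<close>

text \<open>A fact is a nested pair of a program code, an encoded argument list and a value.\<close>

definition eval_rule :: "nat set \<Rightarrow> nat \<Rightarrow> bool" where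
  "eval_rule X p \<longleftrightarrow>
    (let c = pfst p; xs = pfst (psnd p); v = psnd (psnd p); a = psnd c in
      (pfst c = 0 \<and> v = 0) \<or>
      (pfst c = 1 \<and> xs \<noteq> 0 \<and> v = Suc (list_hd xs)) \<or>
      (pfst c = 2 \<and> a < list_len xs \<and> v = list_nth xs a) \<or>
      (pfst c = 3 \<and> (\<exists>q\<in>X. pfst q = pfst a \<and> psnd (psnd q) = v \<and>
         list_len (pfst (psnd q)) = list_len (psnd a) \<and>
         (\<forall>k<list_len (psnd a).
            pair (list_nth (psnd a) k) (pair xs (list_nth (pfst (psnd q)) k)) \<in> X))) \<or>
      (pfst c = 4 \<and> xs \<noteq> 0 \<and> list_hd xs = 0 \<and> pair (pfst a) (pair (list_tl xs) v) \<in> X) \<or>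
      (pfst c = 4 \<and> xs \<noteq> 0 \<and> list_hd xs \<noteq> 0 \<and>
         (\<exists>q\<in>X. pfst q = c \<and> pfst (psnd q) = list_cons (list_hd xs - 1) (list_tl xs) \<and>
            pair (psnd a) (pair (list_cons (list_hd xs - 1)
              (list_cons (psnd (psnd q)) (list_tl xs))) v) \<in> X)) \<or>
      (pfst c = 5 \<and> pair a (pair (list_cons v xs) 0) \<in> X \<and>
         (\<forall>m<v. \<exists>q\<in>X. pfst q = a \<and> pfst (psnd q) = list_cons m xs \<and> psnd (psnd q) \<noteq> 0)))"

abbreviation eval_fact :: "recf \<Rightarrow> nat list \<Rightarrow> nat \<Rightarrow> nat" where
  "eval_fact c xs v \<equiv> pair (code c) (pair (list_encode xs) v)"

lemma mono_eval_rule: "mono eval_rule"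
proof (intro monoI le_funI le_boolI)
  show "eval_rule X p \<Longrightarrow> eval_rule Y p" if "X \<subseteq> Y" for X Y p
    using that unfolding eval_rule_def Let_def
    by (elim disj_forward conj_forward) (blast | assumption)+
qed

lemma decidable_eval_rule:
  "computable f \<Longrightarrow> computable g \<Longrightarrow> decidable (\<lambda>x. eval_rule (set (list_decode (f x))) (g x))"
proof -
  have "decidable (\<lambda>z. eval_rule (set (list_decode (pfst z))) (psnd z))"
    unfolding eval_rule_def Let_def by (intro computable_intros)
  then show "computable f \<Longrightarrow> computable g \<Longrightarrow> ?thesis"
    using decidable_comp[OF _ computable_pair[of f g]] by fastforce
qed

lemma those_eq_Some: "those ys = Some vs \<longleftrightarrow> ys = map Some vs"
proof (induction ys arbitrary: vs)
  case (Cons y ys)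
  then show ?case by (cases vs; cases y) auto
qed auto

lemma eval_Comp_iff:
  "eval (Comp f gs) xs = Some v \<longleftrightarrow>
    (\<exists>vs. length vs = length gs \<and> (\<forall>k<length gs. eval (gs ! k) xs = Some (vs ! k)) \<and> eval f vs = Some v)"
proof -
  have "those (map (\<lambda>g. eval g xs) gs) = Some vs \<longleftrightarrow>
      length vs = length gs \<and> (\<forall>k<length gs. eval (gs ! k) xs = Some (vs ! k))" for vs
    by (auto simp: those_eq_Some list_eq_iff_nth_eq)
  then show ?thesis by (auto simp: bind_eq_Some_conv)
qed

lemma eval_Prim_Suc_iff:
  "eval (Prim f g) (Suc n # ys) = Some v \<longleftrightarrow>
    (\<exists>r. eval (Prim f g) (n # ys) = Some r \<and> eval g (n # r # ys) = Some v)"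
  by (auto simp: bind_eq_Some_conv)

text \<open>This turns minimisation into a positive condition, as a rule on finite sets of facts
  requires: that a smaller argument is not a zero is expressed by the presence of a fact with a
  nonzero value.\<close>

lemma eval_Mu_iff:
  "eval (Mu f) xs = Some v \<longleftrightarrow>
    eval f (v # xs) = Some 0 \<and> (\<forall>m<v. \<exists>r. r \<noteq> 0 \<and> eval f (m # xs) = Some r)"
proof -
  let ?P = "\<lambda>n. eval f (n # xs) = Some 0 \<and> (\<forall>m<n. eval f (m # xs) \<noteq> None)"
  have "(if Ex P then Some (Least P) else None) = Some v \<longleftrightarrow> P v \<and> (\<forall>m<v. \<not> P m)"
    for P :: "nat \<Rightarrow> bool"
    by (auto intro: LeastI_ex dest: not_less_Least intro!: Least_equality simp flip: not_less)
  from this[of ?P] have "eval (Mu f) xs = Some v \<longleftrightarrow> ?P v \<and> (\<forall>m<v. \<not> ?P m)"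
    by (simp only: eval.simps)
  also have "\<dots> \<longleftrightarrow> eval f (v # xs) = Some 0 \<and> (\<forall>m<v. \<exists>r. r \<noteq> 0 \<and> eval f (m # xs) = Some r)"
  proof (intro iffI conjI allI impI; elim conjE)
    fix m assume v: "\<forall>m<v. eval f (m # xs) \<noteq> None" "\<forall>m<v. \<not> ?P m" and m: "m < v"
    then obtain r where r: "eval f (m # xs) = Some r" by blast
    \<comment> \<open>If the value at \<open>m\<close> were 0, then \<open>m\<close> itself would
      satisfy \<open>?P\<close>, since all values below \<open>v\<close> are defined.\<close>
    with v m have "r \<noteq> 0" by (metis less_trans)
    with r show "\<exists>r. r \<noteq> 0 \<and> eval f (m # xs) = Some r" by blast
  qed fastforce+
  finally show ?thesis .
qed

definition eval_facts :: "nat set" where "eval_facts = certified eval_rule"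

lemma eval_facts_unfold: "p \<in> eval_facts \<Longrightarrow> eval_rule eval_facts p"
  unfolding eval_facts_def by (rule certified_unfold[OF mono_eval_rule])

lemma eval_factsI: "finite Y \<Longrightarrow> Y \<subseteq> eval_facts \<Longrightarrow> eval_rule Y p \<Longrightarrow> p \<in> eval_facts"
  unfolding eval_facts_def by (rule certifiedI[OF mono_eval_rule])

lemma eval_fact_sound: "eval_fact c xs v \<in> eval_facts \<Longrightarrow> eval c xs = Some v"
proof (induction c arbitrary: xs v)
  case Zero
  from eval_facts_unfold[OF this] show ?case by (simp add: eval_rule_def)
next
  case Succ
  from eval_facts_unfold[OF this] show ?case
    by (cases xs) (auto simp: eval_rule_def)
next
  case (Proj i)
  from eval_facts_unfold[OF this] show ?case by (simp add: eval_rule_def)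
next
  case (Comp f gs)
  from eval_facts_unfold[OF Comp.prems] obtain q
    where q: "q \<in> eval_facts" "pfst q = code f" "psnd (psnd q) = v"
      "list_len (pfst (psnd q)) = length gs"
      "\<And>k. k < length gs \<Longrightarrow> pair (code (gs ! k)) (pair (list_encode xs) (list_nth (pfst (psnd q)) k))
         \<in> eval_facts"
    by (auto simp: eval_rule_def)
  define vs where "vs = list_decode (pfst (psnd q))"
  then have vs: "pfst (psnd q) = list_encode vs" by simp
  then have "q = eval_fact f vs v"
    using q(2,3) by (metis prod.collapse prod_decode_inverse)
  with q(1) Comp.IH(1) have "eval f vs = Some v" by simp
  moreover have "length vs = length gs" using q(4) vs by simp
  moreover have "eval (gs ! k) xs = Some (vs ! k)" if "k < length gs" for k
    using Comp.IH(2)[of "gs ! k"] q(5)[OF that] vs that \<open>length vs = length gs\<close> by simp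
  ultimately show ?case unfolding eval_Comp_iff by blast
next
  case (Prim f g)
  from eval_facts_unfold[OF Prim.prems] obtain n ys where xs: "xs = n # ys"
    by (cases xs) (auto simp: eval_rule_def)
  \<comment> \<open>The premise for a successor concerns the same program, so structural induction
    does not reach it; the inner induction on the counter excludes circular certificates
    here.\<close>
  from Prim.prems show ?case unfolding xs
  proof (induction n arbitrary: v)
    case 0
    from eval_facts_unfold[OF this] Prim.IH(1) show ?case
      by (simp add: eval_rule_def)
  next
    case (Suc n)
    from eval_facts_unfold[OF Suc.prems] obtain q
      where q: "q \<in> eval_facts" "pfst q = code (Prim f g)"
        "pfst (psnd q) = list_encode (n # ys)"
        "eval_fact g (n # psnd (psnd q) # ys) v \<in> eval_facts"
      by (auto simp: eval_rule_def)
    then have "q = eval_fact (Prim f g) (n # ys) (psnd (psnd q))"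
      by (metis prod.collapse prod_decode_inverse)
    with q(1) Suc.IH have "eval (Prim f g) (n # ys) = Some (psnd (psnd q))" by metis
    with Prim.IH(2)[OF q(4)] show ?case unfolding eval_Prim_Suc_iff by blast
  qed
next
  case (Mu f)
  from eval_facts_unfold[OF Mu.prems]
  have f: "eval_fact f (v # xs) 0 \<in> eval_facts"
    "\<And>m. m < v \<Longrightarrow> \<exists>q\<in>eval_facts. pfst q = code f \<and>
       pfst (psnd q) = list_encode (m # xs) \<and> psnd (psnd q) \<noteq> 0"
    by (auto simp: eval_rule_def Let_def)
  have "\<exists>r. r \<noteq> 0 \<and> eval f (m # xs) = Some r" if "m < v" for m
  proof -
    from f(2)[OF that] obtain q where q: "q \<in> eval_facts" "pfst q = code f"
       "pfst (psnd q) = list_encode (m # xs)" "psnd (psnd q) \<noteq> 0" by blast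
    then have "q = eval_fact f (m # xs) (psnd (psnd q))"
      by (metis prod.collapse prod_decode_inverse)
    with q Mu.IH show ?thesis by metis
  qed
  with Mu.IH[OF f(1)] show ?case unfolding eval_Mu_iff by blast
qed

text \<open>Each evaluation rests on finitely many facts supplied by the induction hypotheses. For
  \<open>Mu\<close> these are the value 0 at \<open>v\<close> and one nonzero value at every smaller
  argument.\<close>

lemma eval_fact_complete: "eval c xs = Some v \<Longrightarrow> eval_fact c xs v \<in> eval_facts"
proof (induction c arbitrary: xs v)
  case Zero
  then show ?case
    by (intro eval_factsI[of "{}"]) (auto simp: eval_rule_def)
next
  case Succ
  then show ?case
    by (intro eval_factsI[of "{}"]) (auto simp: eval_rule_def split: list.splits)
next
  case (Proj i)
  then show ?case
    by (intro eval_factsI[of "{}"]) (auto simp: eval_rule_def split: if_splits)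
next
  case (Comp f gs)
  from Comp.prems obtain vs where vs: "length vs = length gs"
    "\<And>k. k < length gs \<Longrightarrow> eval (gs ! k) xs = Some (vs ! k)" "eval f vs = Some v"
    unfolding eval_Comp_iff by blast
  let ?Y = "insert (eval_fact f vs v) ((\<lambda>k. eval_fact (gs ! k) xs (vs ! k)) ` {..<length gs})"
  show ?case
  proof (rule eval_factsI[of ?Y])
    show "?Y \<subseteq> eval_facts" using Comp.IH vs by auto
    show "eval_rule ?Y (eval_fact (Comp f gs) xs v)" by (auto simp: eval_rule_def vs(1))
  qed auto
next
  case (Prim f g)
  from Prim.prems obtain n ys where xs: "xs = n # ys" by (cases xs) auto
  from Prim.prems show ?case unfolding xs
  proof (induction n arbitrary: v)
    case 0
    with Prim.IH(1) show ?case
      by (intro eval_factsI[of "{eval_fact f ys v}"]) (auto simp: eval_rule_def)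
  next
    case (Suc n)
    then obtain r where r: "eval (Prim f g) (n # ys) = Some r" "eval g (n # r # ys) = Some v"
      unfolding eval_Prim_Suc_iff by blast
    show ?case
      by (rule eval_factsI[of "{eval_fact (Prim f g) (n # ys) r, eval_fact g (n # r # ys) v}"])
        (use Suc.IH[OF r(1)] Prim.IH(2)[OF r(2)] in \<open>auto simp: eval_rule_def\<close>)
  qed
next
  case (Mu f)
  from Mu.prems have f: "eval f (v # xs) = Some 0"
    and "\<forall>m<v. \<exists>r. r \<noteq> 0 \<and> eval f (m # xs) = Some r"
    unfolding eval_Mu_iff by auto
  then obtain r where r: "\<And>m. m < v \<Longrightarrow> r m \<noteq> 0 \<and> eval f (m # xs) = Some (r m)" by metis
  let ?Y = "insert (eval_fact f (v # xs) 0) ((\<lambda>m. eval_fact f (m # xs) (r m)) ` {..<v})"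
  show ?case
  proof (rule eval_factsI[of ?Y])
    have "eval_fact f (m # xs) (r m) \<in> eval_facts" if "m < v" for m
      using Mu.IH r that by blast
    with Mu.IH[OF f] show "?Y \<subseteq> eval_facts" by blast
    show "eval_rule ?Y (eval_fact (Mu f) xs v)" using r by (auto simp: eval_rule_def)
  qed auto
qed

text \<open>The first argument ranges over all numbers; nothing is claimed for numbers that are not codes.\<close>

definition eval_code :: "nat \<Rightarrow> nat \<Rightarrow> nat \<Rightarrow> bool" where
  "eval_code c x v \<longleftrightarrow> pair c (pair (list_cons x 0) v) \<in> eval_facts"

lemma eval_code_iff: "eval_code (code c) x v \<longleftrightarrow> eval c [x] = Some v"
  using eval_fact_sound[of c "[x]" v] eval_fact_complete[of c "[x]" v] by (auto simp: eval_code_def)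

lemma semidecidable_eval_code:
  "computable f \<Longrightarrow> computable g \<Longrightarrow> computable h \<Longrightarrow> semidecidable (\<lambda>x. eval_code (f x) (g x) (h x))"
  unfolding eval_code_def eval_facts_def
  by (rule semidecidable_comp[OF semidecidable_certified[of eval_rule, OF decidable_eval_rule]])
    (assumption | intro computable_intros)+

text \<open>From left to right the universal evaluation relation is projected along the value.
  Conversely, minimising over the witness \<open>t\<close> with a total program for \<open>Q\<close>
  halts exactly when a witness exists.\<close>

lemma RE_iff_semidecidable: "RE A \<longleftrightarrow> semidecidable (\<lambda>x. x \<in> A)"
proof
  assume "RE A"
  then obtain i where A: "A = W i" unfolding RE_def by blast
  show "semidecidable (\<lambda>x. x \<in> A)"
  proof (cases "\<exists>c. code c = i")
    case True
    then obtain c where c: "code c = i" ..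
    then have "x \<in> A \<longleftrightarrow> (\<exists>v. eval_code i x v)" for x
      by (auto simp: A W_def eval_code_iff dest: code_inject)
    moreover have "semidecidable (\<lambda>x. \<exists>v. eval_code i x v)"
      by (intro semidecidable_ex semidecidable_eval_code computable_intros)
    ultimately show ?thesis by simp
  next
    case False
    then have "x \<in> A \<longleftrightarrow> False" for x by (auto simp: A W_def)
    then show ?thesis by (auto intro: decidable_imp_semidecidable computable_intros)
  qed
next
  assume "semidecidable (\<lambda>x. x \<in> A)"
  then obtain Q where Q: "decidable (\<lambda>z. Q (pfst z) (psnd z))" and A: "\<And>x. x \<in> A \<longleftrightarrow> (\<exists>t. Q t x)"
    unfolding semidecidable_def by blast
  from decidable_not[OF Q] obtain c
    where c: "\<And>z. eval c [z] = Some (of_bool (\<not> Q (pfst z) (psnd z)))"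
    unfolding decidable_def computable_def by blast
  have "eval (Comp c [pair_prog]) [t, x] = Some (of_bool (\<not> Q t x))" for t x
    by (simp add: c)
  then have "eval (Mu (Comp c [pair_prog])) [x] \<noteq> None \<longleftrightarrow> x \<in> A" for x
    using eval_Mu_total[of "Comp c [pair_prog]" "[x]" "\<lambda>t. of_bool (\<not> Q t x)"] by (simp add: A)
  then have "A = W (code (Mu (Comp c [pair_prog])))"
    unfolding W_def by (auto dest: code_inject simp del: code.simps eval.simps)
  then show "RE A" unfolding RE_def by blast
qed

section \<open>The recursion theorem with parameters\<close>

lemma mem_W_code: "x \<in> W (code c) \<longleftrightarrow> eval c [x] \<noteq> None"
  by (auto simp: W_def dest: code_inject)

text \<open>Nonemptiness ensures that \<open>i\<close> is a code. Otherwise the equivalence can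
  fail: \<open>pair 0 1\<close> codes no program, yet \<open>eval_rule\<close> looks only at the tag
  0 and grants it the value 0 everywhere.\<close>

lemma mem_W_iff_eval_code: "W i \<noteq> {} \<Longrightarrow> x \<in> W i \<longleftrightarrow> (\<exists>v. eval_code i x v)"
  unfolding W_def by (fastforce simp: eval_code_iff dest: code_inject)

text \<open>The code of \<open>const_prog n\<close> computed on numbers: \<open>pair 0 0\<close> and
  \<open>pair 1 0\<close> are the codes of \<open>Zero\<close> and \<open>Succ\<close>, and 3 is the
  tag of \<open>Comp\<close>.\<close>

definition const_code :: "nat \<Rightarrow> nat" where
  "const_code n = rec_nat (pair 0 0) (\<lambda>_ r. pair 3 (pair (pair 1 0) (list_cons r 0))) n"

lemma code_const_prog: "code (const_prog n) = const_code n"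
  by (induction n) (simp_all add: const_code_def)

definition specialize :: "recf \<Rightarrow> nat \<Rightarrow> recf" where
  "specialize c k = Comp c [Comp pair_prog [const_prog k, Proj 0]]"

text \<open>The numerical counterpart of \<open>specialize\<close>, defined for all numbers
  \<open>c\<close>, so that it is a total computable function of both arguments.\<close>

definition specialize_code :: "nat \<Rightarrow> nat \<Rightarrow> nat" where
  "specialize_code c k = pair 3 (pair c (list_cons (pair 3 (pair (code pair_prog)
     (list_cons (const_code k) (list_cons (code (Proj 0)) 0)))) 0))"

lemma code_specialize: "code (specialize c k) = specialize_code (code c) k"
  by (simp add: specialize_def specialize_code_def code_const_prog)

lemma eval_specialize: "eval (specialize c k) [x] = eval c [pair k x]"
  by (simp add: specialize_def)

lemma computable_specialize_code:
  "computable f \<Longrightarrow> computable g \<Longrightarrow> computable (\<lambda>x. specialize_code (f x) (g x))"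
  unfolding specialize_code_def const_code_def by (intro computable_intros)

text \<open>Kleene's diagonal argument. A number \<open>y\<close> is read as a pair of a program
  code and a parameter, and \<open>?diag y\<close> hardwires \<open>y\<close> into that program. If
  \<open>c\<close> has domain \<open>?D\<close>, then hardwiring \<open>pair (code c) p\<close> into
  \<open>c\<close> gives a program whose own code is what \<open>?D\<close> passes to
  \<open>R\<close>.\<close>

theorem recursion_theorem:
  assumes "semidecidable (\<lambda>z. R (pfst z) (pfst (psnd z)) (psnd (psnd z)))"
  obtains s where "computable s" "\<And>p x. x \<in> W (s p) \<longleftrightarrow> R (s p) p x"
proof -
  let ?diag = "\<lambda>y. specialize_code (pfst y) y"
  let ?D = "\<lambda>z. R (?diag (pfst z)) (psnd (pfst z)) (psnd z)"
  have "semidecidable ?D"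
    using semidecidable_comp[OF assms,
        of "\<lambda>z. pair (?diag (pfst z)) (pair (psnd (pfst z)) (psnd z))"]
    by (simp add: computable_specialize_code computable_intros)
  then have "RE {z. ?D z}"
    by (simp add: RE_iff_semidecidable)
  then obtain i where i: "{z. ?D z} = W i" unfolding RE_def by blast
  \<comment> \<open>An actual program is wanted, not just an index. If \<open>i\<close> is not a
    code, the set is empty and \<open>Mu Succ\<close> serves, since \<open>Succ\<close> never takes
    the value 0.\<close>
  obtain c where c: "\<And>z. eval c [z] \<noteq> None \<longleftrightarrow> ?D z"
  proof (cases "\<exists>c. code c = i")
    case True
    then obtain c where "code c = i" ..
    then have "eval c [z] \<noteq> None \<longleftrightarrow> ?D z" for z
      unfolding mem_W_code[symmetric] using i by (simp add: set_eq_iff)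
    then show thesis by (rule that)
  next
    case False
    then have "W i = {}" by (auto simp: W_def)
    then have "eval (Mu Succ) [z] \<noteq> None \<longleftrightarrow> ?D z" for z
      using i by auto
    then show thesis by (rule that)
  qed
  show thesis
  proof
    show "computable (\<lambda>p. ?diag (pair (code c) p))"
      by (intro computable_specialize_code computable_intros)
    show "x \<in> W (?diag (pair (code c) p)) \<longleftrightarrow> R (?diag (pair (code c) p)) p x" for p x
    proof -
      have "?diag (pair (code c) p) = code (specialize c (pair (code c) p))"
        by (simp add: code_specialize)
      then have "x \<in> W (?diag (pair (code c) p)) \<longleftrightarrow> eval c [pair (pair (code c) p) x] \<noteq> None"
        by (simp only: mem_W_code eval_specialize)
      then show ?thesis by (simp only: c) simp
    qed
  qed
qed

text \<open>The instance of the recursion theorem for relations that ignore their own index.\<close>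

corollary smn_theorem:
  assumes "semidecidable (\<lambda>z. R (pfst z) (psnd z))"
  obtains s where "computable s" "\<And>p x. x \<in> W (s p) \<longleftrightarrow> R p x"
proof (rule recursion_theorem[of "\<lambda>_. R"])
  show "semidecidable (\<lambda>z. R (pfst (psnd z)) (psnd (psnd z)))"
    by (rule semidecidable_comp[OF assms computable_psnd_id])
qed (rule that)

section \<open>Non-sentences\<close>

lemma mem_less_list_encode: "x \<in> set xs \<Longrightarrow> x < list_encode xs"
proof (induction xs)
  case (Cons y xs)
  have "y \<le> pair y (list_encode xs)" "list_encode xs \<le> pair y (list_encode xs)"
    by (rule le_prod_encode_1 le_prod_encode_2)+
  with Cons show ?case by auto
qed simp

text \<open>For induction on Goedel numbers: compound expressions carry positive tags, so their
  components are strictly smaller. With tag 0 this fails, as \<open>pair 0 0 = 0\<close>.\<close>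

lemma less_prod_encode: "0 < a \<Longrightarrow> b < pair a b"
proof -
  assume "0 < a"
  have "n \<le> triangle n" for n by (induction n) auto
  from this[of "a + b"] \<open>0 < a\<close> show ?thesis by (simp add: prod_encode_def)
qed

text \<open>The facts are nested pairs of a flag (0 for formulas, 1 for terms), a bound \<open>k\<close> and a number that is
  not the Goedel number of a well-formed expression with all free indices below \<open>k\<close>.\<close>

definition bad_args :: "nat list \<Rightarrow> nat set \<Rightarrow> nat \<Rightarrow> nat \<Rightarrow> bool" where
  "bad_args ar X k a \<longleftrightarrow>
     length ar \<le> pfst a \<or> list_len (psnd a) \<noteq> list_nth (list_encode ar) (pfst a) \<or>
     (\<exists>j<list_len (psnd a). pair 1 (pair k (list_nth (psnd a) j)) \<in> X)"

text \<open>Failure is caused by a single defect, a wrong tag, symbol, arity or index, which is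
  passed up through the enclosing expressions. Hence all clauses are positive in \<open>X\<close>. A
  number with tag 0 and \<open>a \<noteq> 0\<close> is bad as a formula because \<open>Bot\<close>
  is coded by \<open>pair 0 0\<close>.\<close>

definition bad_rule :: "signature \<Rightarrow> nat set \<Rightarrow> nat \<Rightarrow> bool" where
  "bad_rule L X p \<longleftrightarrow>
    (let k = pfst (psnd p); n = psnd (psnd p); a = psnd n in
      (pfst p = 0 \<and> pfst n = 0 \<and> a \<noteq> 0) \<or>
      (pfst p = 0 \<and> pfst n = 1 \<and> (pair 1 (pair k (pfst a)) \<in> X \<or> pair 1 (pair k (psnd a)) \<in> X)) \<or>
      (pfst p = 0 \<and> pfst n = 2 \<and> bad_args (rel_arities L) X k a) \<or>
      (pfst p = 0 \<and> pfst n = 3 \<and> (pair 0 (pair k (pfst a)) \<in> X \<or> pair 0 (pair k (psnd a)) \<in> X)) \<or>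
      (pfst p = 0 \<and> pfst n = 4 \<and> pair 0 (pair (Suc k) a) \<in> X) \<or>
      (pfst p = 0 \<and> 4 < pfst n) \<or>
      (pfst p = 1 \<and> pfst n = 0 \<and> k \<le> a) \<or>
      (pfst p = 1 \<and> pfst n = 1 \<and> bad_args (fun_arities L) X k a) \<or>
      (pfst p = 1 \<and> 1 < pfst n))"

definition bad_facts :: "signature \<Rightarrow> nat set" where
  "bad_facts L = certified (bad_rule L)"

lemma mono_bad_rule: "mono (bad_rule L)"
proof (intro monoI le_funI le_boolI)
  show "bad_rule L X p \<Longrightarrow> bad_rule L Y p" if "X \<subseteq> Y" for X Y p
    using that unfolding bad_rule_def bad_args_def Let_def
    by (elim disj_forward conj_forward) (blast | assumption)+
qed

lemma bad_facts_unfold: "p \<in> bad_facts L \<Longrightarrow> bad_rule L (bad_facts L) p"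
  unfolding bad_facts_def by (rule certified_unfold[OF mono_bad_rule])

lemma bad_factsI: "finite Y \<Longrightarrow> Y \<subseteq> bad_facts L \<Longrightarrow> bad_rule L Y p \<Longrightarrow> p \<in> bad_facts L"
  unfolding bad_facts_def by (rule certifiedI[OF mono_bad_rule])

lemma semidecidable_bad_facts: "semidecidable (\<lambda>p. p \<in> bad_facts L)"
proof -
  have "decidable (\<lambda>z. bad_rule L (set (list_decode (pfst z))) (psnd z))"
    unfolding bad_rule_def bad_args_def Let_def by (intro computable_intros)
  from decidable_comp[OF this computable_pair] show ?thesis
    unfolding bad_facts_def by (intro semidecidable_certified) simp
qed

abbreviation good_tm :: "signature \<Rightarrow> nat \<Rightarrow> nat \<Rightarrow> bool" where
  "good_tm L k n \<equiv> \<exists>t. wf_tm L t \<and> closed_tm k t \<and> gn_tm t = n"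

abbreviation good_fm :: "signature \<Rightarrow> nat \<Rightarrow> nat \<Rightarrow> bool" where
  "good_fm L k n \<equiv> \<exists>\<phi>. wf_fm L \<phi> \<and> closed_fm k \<phi> \<and> gn \<phi> = n"

lemma bad_tm_sound: "pair 1 (pair k (gn_tm t)) \<in> bad_facts L \<Longrightarrow> \<not> (wf_tm L t \<and> closed_tm k t)"
proof (induction t)
  case (Var n)
  from bad_facts_unfold[OF this] show ?case by (simp add: bad_rule_def)
next
  case (Fun f ts)
  from bad_facts_unfold[OF Fun.prems] have "length (fun_arities L) \<le> f \<or>
      length ts \<noteq> list_nth (list_encode (fun_arities L)) f \<or>
      (\<exists>j<length ts. pair 1 (pair k (gn_tm (ts ! j))) \<in> bad_facts L)"
    by (auto simp: bad_rule_def bad_args_def)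
  then show ?case using Fun.IH[OF nth_mem] nth_mem[of _ ts] by (fastforce simp: not_le)
qed

text \<open>One bad argument suffices, so the rule fires from no premise or from a single one, which
  keeps the set passed to \<open>bad_factsI\<close> explicit.\<close>

lemma bad_args_cases:
  assumes "\<not> (f < length ar \<and> length ns = ar ! f \<and> (\<forall>n\<in>set ns. good_tm L k n))"
  obtains "bad_args ar {} k (pair f (list_encode ns))"
  | n where "n \<in> set ns" "\<not> good_tm L k n" "bad_args ar {pair 1 (pair k n)} k (pair f (list_encode ns))"
proof (cases "f < length ar \<and> length ns = ar ! f")
  case True
  with assms obtain j where "j < length ns" "\<not> good_tm L k (ns ! j)"
    by (auto simp: in_set_conv_nth)
  then show thesis by (intro that(2)[of "ns ! j"]) (auto simp: bad_args_def)
next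
  case False
  then show thesis by (intro that(1)) (auto simp: bad_args_def not_le)
qed

lemma good_args_obtain:
  assumes "\<forall>n\<in>set ns. good_tm L k n"
  obtains ts where "\<forall>t\<in>set ts. wf_tm L t \<and> closed_tm k t" "map gn_tm ts = ns"
proof -
  from assms obtain g
    where "\<And>n. n \<in> set ns \<Longrightarrow> wf_tm L (g n) \<and> closed_tm k (g n) \<and> gn_tm (g n) = n" by metis
  then show thesis
    by (intro that[of "map g ns"]) (auto intro: map_idI)
qed

text \<open>The induction is on the number, as \<open>n\<close> need not code any term. If all
  components were good, they could be reassembled into a good term with code
  \<open>n\<close>.\<close>

lemma bad_tm_complete: "\<not> good_tm L k n \<Longrightarrow> pair 1 (pair k n) \<in> bad_facts L"
proof (induction n rule: less_induct)
  case (less n)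
  obtain tag a where n: "n = pair tag a" by (metis prod.exhaust prod_decode_inverse)
  consider "tag = 0" | "tag = 1" | "1 < tag" by linarith
  then show ?case
  proof cases
    case 1
    have "\<not> a < k" using less.prems[unfolded n 1] by (metis closed_tm.simps(1) gn_tm.simps(1) wf_tm.simps(1))
    then show ?thesis
      by (intro bad_factsI[of "{}"]) (auto simp: bad_rule_def n 1)
  next
    case 2
    define f ns where "f = pfst a" "ns = list_decode (psnd a)"
    then have a: "a = pair f (list_encode ns)" by simp
    have "\<not> (f < length (fun_arities L) \<and> length ns = fun_arities L ! f \<and> (\<forall>n\<in>set ns. good_tm L k n))"
    proof
      assume "f < length (fun_arities L) \<and> length ns = fun_arities L ! f \<and> (\<forall>n\<in>set ns. good_tm L k n)"
      moreover from this obtain ts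
        where "\<forall>t\<in>set ts. wf_tm L t \<and> closed_tm k t" "map gn_tm ts = ns"
        using good_args_obtain by blast
      ultimately have "wf_tm L (Fun f ts)" "closed_tm k (Fun f ts)" "gn_tm (Fun f ts) = n"
        by (auto simp: n a 2)
      with less.prems show False by blast
    qed
    then show ?thesis
    proof (cases rule: bad_args_cases)
      case 1
      with 2 show ?thesis
        by (intro bad_factsI[of "{}"]) (auto simp: bad_rule_def n a)
    next
      case (2 m)
      have "m < list_encode ns" using 2(1) by (rule mem_less_list_encode)
      also have "\<dots> \<le> a" unfolding a by (rule le_prod_encode_2)
      also have "\<dots> \<le> n" unfolding n by (rule le_prod_encode_2)
      finally have "pair 1 (pair k m) \<in> bad_facts L" using less.IH 2(2) by blast
      with 2(3) \<open>tag = 1\<close> show ?thesis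
        by (intro bad_factsI[of "{pair 1 (pair k m)}"]) (auto simp: bad_rule_def n a)
    qed
  next
    case 3
    then show ?thesis by (intro bad_factsI[of "{}"]) (auto simp: bad_rule_def n)
  qed
qed

lemma bad_fm_sound: "pair 0 (pair k (gn \<phi>)) \<in> bad_facts L \<Longrightarrow> \<not> (wf_fm L \<phi> \<and> closed_fm k \<phi>)"
proof (induction \<phi> arbitrary: k)
  case Bot
  from bad_facts_unfold[OF this] show ?case by (simp add: bad_rule_def)
next
  case (Eq s t)
  from bad_facts_unfold[OF this] show ?case
    using bad_tm_sound[of k s L] bad_tm_sound[of k t L] by (auto simp: bad_rule_def)
next
  case (Rel r ts)
  from bad_facts_unfold[OF this] have "length (rel_arities L) \<le> r \<or>
      length ts \<noteq> list_nth (list_encode (rel_arities L)) r \<or>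
      (\<exists>j<length ts. pair 1 (pair k (gn_tm (ts ! j))) \<in> bad_facts L)"
    by (auto simp: bad_rule_def bad_args_def)
  then show ?case using bad_tm_sound[of k _ L] nth_mem[of _ ts] by (fastforce simp: not_le)
next
  case (Imp \<phi> \<psi>)
  from bad_facts_unfold[OF Imp.prems] Imp.IH show ?case by (auto simp: bad_rule_def)
next
  case (All \<phi>)
  from bad_facts_unfold[OF All.prems] All.IH show ?case by (auto simp: bad_rule_def)
qed

lemma bad_fm_complete: "\<not> good_fm L k n \<Longrightarrow> pair 0 (pair k n) \<in> bad_facts L"
proof (induction n arbitrary: k rule: less_induct)
  case (less n)
  obtain tag a where n: "n = pair tag a" by (metis prod.exhaust prod_decode_inverse)
  obtain b c where a: "a = pair b c" by (metis prod.exhaust prod_decode_inverse)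
  have lt: "b < n" "c < n" "a < n" if "0 < tag"
    using less_prod_encode[OF that, of a] le_prod_encode_1[of b c] le_prod_encode_2[of c b]
    unfolding n a by linarith+
  consider "tag = 0" | "tag = 1" | "tag = 2" | "tag = 3" | "tag = 4" | "4 < tag" by linarith
  then show ?case
  proof cases
    case 1
    have "a \<noteq> 0"
    proof
      assume "a = 0"
      then have "gn Bot = n" by (simp add: n 1)
      with less.prems show False by (metis closed_fm.simps(1) wf_fm.simps(1))
    qed
    then show ?thesis by (intro bad_factsI[of "{}"]) (auto simp: bad_rule_def n 1)
  next
    case 2
    have "\<not> (good_tm L k b \<and> good_tm L k c)"
    proof
      assume "good_tm L k b \<and> good_tm L k c"
      then obtain s t where "wf_fm L (Eq s t)" "closed_fm k (Eq s t)" "gn (Eq s t) = n"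
        by (auto simp: n a 2)
      with less.prems show False by blast
    qed
    then obtain m where "m = b \<or> m = c" "pair 1 (pair k m) \<in> bad_facts L"
      using bad_tm_complete by blast
    then show ?thesis
      by (intro bad_factsI[of "{pair 1 (pair k m)}"]) (auto simp: bad_rule_def n a 2)
  next
    case 3
    define ns where "ns = list_decode c"
    then have c: "c = list_encode ns" by simp
    have "\<not> (b < length (rel_arities L) \<and> length ns = rel_arities L ! b \<and> (\<forall>n\<in>set ns. good_tm L k n))"
    proof
      assume "b < length (rel_arities L) \<and> length ns = rel_arities L ! b \<and> (\<forall>n\<in>set ns. good_tm L k n)"
      moreover from this obtain ts
        where "\<forall>t\<in>set ts. wf_tm L t \<and> closed_tm k t" "map gn_tm ts = ns"
        using good_args_obtain by blast
      ultimately have "wf_fm L (Rel b ts)" "closed_fm k (Rel b ts)" "gn (Rel b ts) = n"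
        by (auto simp: n a c 3)
      with less.prems show False by blast
    qed
    then show ?thesis
    proof (cases rule: bad_args_cases)
      case 1
      with 3 show ?thesis
        by (intro bad_factsI[of "{}"]) (auto simp: bad_rule_def n a c)
    next
      case (2 m)
      with 3 bad_tm_complete[OF 2(2)] show ?thesis
        by (intro bad_factsI[of "{pair 1 (pair k m)}"]) (auto simp: bad_rule_def n a c)
    qed
  next
    case 4
    have "\<not> (good_fm L k b \<and> good_fm L k c)"
    proof
      assume "good_fm L k b \<and> good_fm L k c"
      then obtain \<phi> \<psi> where "wf_fm L (Imp \<phi> \<psi>)" "closed_fm k (Imp \<phi> \<psi>)" "gn (Imp \<phi> \<psi>) = n"
        by (auto simp: n a 4)
      with less.prems show False by blast
    qed
    then obtain m where "m = b \<or> m = c" "pair 0 (pair k m) \<in> bad_facts L"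
      using less.IH lt 4 by (metis zero_less_numeral)
    then show ?thesis
      by (intro bad_factsI[of "{pair 0 (pair k m)}"]) (auto simp: bad_rule_def n a 4)
  next
    case 5
    have "\<not> good_fm L (Suc k) a"
    proof
      assume "good_fm L (Suc k) a"
      then obtain \<phi> where "wf_fm L (All \<phi>)" "closed_fm k (All \<phi>)" "gn (All \<phi>) = n"
        by (auto simp: n 5)
      with less.prems show False by blast
    qed
    then have "pair 0 (pair (Suc k) a) \<in> bad_facts L"
      using less.IH lt 5 by simp
    then show ?thesis
      by (intro bad_factsI[of "{pair 0 (pair (Suc k) a)}"]) (auto simp: bad_rule_def n 5)
  next
    case 6
    then show ?thesis by (intro bad_factsI[of "{}"]) (auto simp: bad_rule_def n)
  qed
qed

lemma semidecidable_not_sentence: "semidecidable (\<lambda>n. n \<notin> gn ` sentences L)"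
proof -
  have "n \<notin> gn ` sentences L \<longleftrightarrow> pair 0 (pair 0 n) \<in> bad_facts L" for n
    using bad_fm_sound[of 0 _ L] bad_fm_complete[of L 0 n] by (auto simp: sentences_def)
  then show ?thesis
    using semidecidable_comp[OF semidecidable_bad_facts, of "\<lambda>n. pair 0 (pair 0 n)"]
    by (simp add: computable_intros)
qed

section \<open>Derivability\<close>

lemma proves_weaken: "proves L \<Gamma> \<phi> \<Longrightarrow> \<Gamma> \<subseteq> \<Delta> \<Longrightarrow> proves L \<Delta> \<phi>"
proof (induction arbitrary: \<Delta> rule: proves.induct)
  case (ImpI \<phi> \<Gamma> \<psi>)
  show ?case by (rule proves.ImpI[OF ImpI.hyps(1) ImpI.IH[OF insert_mono[OF ImpI.prems]]])
next
  case (Contr \<phi> \<Gamma>)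
  show ?case by (rule proves.Contr[OF Contr.hyps(1) Contr.IH[OF insert_mono[OF Contr.prems]]])
next
  case (AllI \<Gamma> \<phi>)
  show ?case by (rule proves.AllI[OF AllI.IH[OF image_mono[OF AllI.prems]]])
next
  case (ImpE \<Gamma> \<phi> \<psi>)
  show ?case by (rule proves.ImpE[OF ImpE.IH(1)[OF ImpE.prems] ImpE.IH(2)[OF ImpE.prems]])
next
  case (AllE \<Gamma> \<phi> t)
  show ?case by (rule proves.AllE[OF AllE.IH[OF AllE.prems] AllE.hyps(2)])
next
  case (EqSubst \<phi> \<Gamma> s t)
  show ?case
    by (rule proves.EqSubst[OF EqSubst.hyps(1) EqSubst.IH(1)[OF EqSubst.prems] EqSubst.IH(2)[OF EqSubst.prems]])
qed (auto intro: proves.Assm proves.EqRefl)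

lemma subst_tm_id: "closed_tm k t \<Longrightarrow> (\<And>n. n < k \<Longrightarrow> \<sigma> n = Var n) \<Longrightarrow> subst_tm \<sigma> t = t"
  by (induction t) (auto intro: map_idI)

lemma subst_fm_id: "closed_fm k \<phi> \<Longrightarrow> (\<And>n. n < k \<Longrightarrow> \<sigma> n = Var n) \<Longrightarrow> subst_fm \<sigma> \<phi> = \<phi>"
proof (induction \<phi> arbitrary: k \<sigma>)
  case (Rel r ts)
  then show ?case by (auto intro!: map_idI subst_tm_id)
next
  case (All \<phi>)
  have "subst_fm (case_nat (Var 0) (\<lambda>n. subst_tm (\<lambda>m. Var (Suc m)) (\<sigma> n))) \<phi> = \<phi>"
    by (rule All.IH[of "Suc k"]) (use All.prems in \<open>auto split: nat.splits\<close>)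
  then show ?case by simp
qed (auto intro: subst_tm_id)

lemma lift_sentence: "\<phi> \<in> sentences L \<Longrightarrow> lift_fm \<phi> = \<phi>"
  unfolding lift_fm_def by (rule subst_fm_id[of 0]) (auto simp: sentences_def)

lemma lift_sentences: "S \<subseteq> sentences L \<Longrightarrow> lift_fm ` S = S"
  using image_cong[of S S lift_fm "\<lambda>\<phi>. \<phi>"] lift_sentence[of _ L] by (simp add: subset_iff)

text \<open>All of \<open>S\<close>, possibly infinite, is replaced at once. \<open>\<Gamma>\<close>
  collects the assumptions introduced by \<open>ImpI\<close> and \<open>Contr\<close>, which may
  have free variables; \<open>S\<close> and \<open>D\<close> consist of sentences and are unchanged
  by the lifting in \<open>AllI\<close>.\<close>

lemma proves_cut:
  assumes "proves L \<Theta> \<psi>" and "\<Theta> \<subseteq> S \<union> \<Gamma>"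
    and S: "S \<subseteq> sentences L" and D: "D \<subseteq> sentences L" and cut: "\<And>\<chi>. \<chi> \<in> S \<Longrightarrow> proves L D \<chi>"
  shows "proves L (D \<union> \<Gamma>) \<psi>"
  using assms(1,2)
proof (induction arbitrary: \<Gamma> rule: proves.induct)
  case (Assm \<phi> \<Theta>)
  show ?case
  proof (cases "\<phi> \<in> S")
    case True
    then show ?thesis by (rule proves_weaken[OF cut]) simp
  next
    case False
    with Assm show ?thesis by (intro proves.Assm) auto
  qed
next
  case (ImpI \<phi> \<Theta> \<psi>)
  have "insert \<phi> \<Theta> \<subseteq> S \<union> insert \<phi> \<Gamma>" using ImpI.prems by blast
  from ImpI.IH[OF this] ImpI.hyps(1) show ?case by (simp add: proves.ImpI)
next
  case (Contr \<phi> \<Theta>)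
  have "insert (Neg \<phi>) \<Theta> \<subseteq> S \<union> insert (Neg \<phi>) \<Gamma>" using Contr.prems by blast
  from Contr.IH[OF this] Contr.hyps(1) show ?case by (simp add: proves.Contr)
next
  case (AllI \<Theta> \<phi>)
  have "lift_fm ` \<Theta> \<subseteq> S \<union> lift_fm ` \<Gamma>"
    using AllI.prems lift_sentences[OF S] by blast
  from AllI.IH[OF this] show ?case
    by (intro proves.AllI) (simp add: image_Un lift_sentences[OF D])
next
  case (ImpE \<Theta> \<phi> \<psi>)
  show ?case by (rule proves.ImpE[OF ImpE.IH(1)[OF ImpE.prems] ImpE.IH(2)[OF ImpE.prems]])
next
  case (AllE \<Theta> \<phi> t)
  show ?case by (rule proves.AllE[OF AllE.IH[OF AllE.prems] AllE.hyps(2)])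
next
  case (EqSubst \<phi> \<Theta> s t)
  show ?case
    by (rule proves.EqSubst[OF EqSubst.hyps(1) EqSubst.IH(1)[OF EqSubst.prems] EqSubst.IH(2)[OF EqSubst.prems]])
qed (auto intro: proves.Assm proves.EqRefl)

section \<open>Derived rules for the defined connectives\<close>

lemma sentences_simps [simp]:
  "Bot \<in> sentences L" "Top \<in> sentences L"
  "Imp \<phi> \<psi> \<in> sentences L \<longleftrightarrow> \<phi> \<in> sentences L \<and> \<psi> \<in> sentences L"
  "Neg \<phi> \<in> sentences L \<longleftrightarrow> \<phi> \<in> sentences L"
  "And \<phi> \<psi> \<in> sentences L \<longleftrightarrow> \<phi> \<in> sentences L \<and> \<psi> \<in> sentences L"
  "Or \<phi> \<psi> \<in> sentences L \<longleftrightarrow> \<phi> \<in> sentences L \<and> \<psi> \<in> sentences L"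
  by (auto simp: sentences_def Top_def Neg_def And_def Or_def)

lemma wf_sentence: "\<phi> \<in> sentences L \<Longrightarrow> wf_fm L \<phi>"
  by (simp add: sentences_def)

lemma wf_Neg [simp]: "wf_fm L (Neg \<phi>) \<longleftrightarrow> wf_fm L \<phi>"
  by (simp add: Neg_def)

lemma proves_NegI: "wf_fm L \<phi> \<Longrightarrow> proves L (insert \<phi> \<Gamma>) Bot \<Longrightarrow> proves L \<Gamma> (Neg \<phi>)"
  unfolding Neg_def by (rule proves.ImpI)

lemma proves_NegE: "proves L \<Gamma> (Neg \<phi>) \<Longrightarrow> proves L \<Gamma> \<phi> \<Longrightarrow> proves L \<Gamma> Bot"
  unfolding Neg_def by (rule proves.ImpE)

lemma proves_insert: "wf_fm L \<phi> \<Longrightarrow> proves L (insert \<phi> \<Gamma>) \<phi>"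
  by (rule proves.Assm) auto

lemma proves_insertI: "proves L \<Gamma> \<psi> \<Longrightarrow> proves L (insert \<phi> \<Gamma>) \<psi>"
  by (rule proves_weaken) auto

lemma proves_Top: "proves L \<Gamma> Top"
  unfolding Top_def by (rule proves_NegI) (auto intro: proves_insert)

lemma proves_AndI:
  assumes "wf_fm L \<phi>" "wf_fm L \<psi>" "proves L \<Gamma> \<phi>" "proves L \<Gamma> \<psi>"
  shows "proves L \<Gamma> (And \<phi> \<psi>)"
  unfolding And_def
proof (rule proves_NegI)
  let ?\<Delta> = "insert (Imp \<phi> (Neg \<psi>)) \<Gamma>"
  have "proves L ?\<Delta> (Neg \<psi>)"
    by (rule proves.ImpE[OF proves_insert proves_insertI[OF assms(3)]]) (simp add: assms)
  then show "proves L ?\<Delta> Bot"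
    by (rule proves_NegE[OF _ proves_insertI[OF assms(4)]])
qed (use assms in auto)

lemma proves_Neg_OrI:
  assumes "wf_fm L \<phi>" "wf_fm L \<psi>" "proves L \<Gamma> (Neg \<phi>)" "proves L \<Gamma> (Neg \<psi>)"
  shows "proves L \<Gamma> (Neg (Or \<phi> \<psi>))"
  unfolding Or_def
proof (rule proves_NegI)
  let ?\<Delta> = "insert (Imp (Neg \<phi>) \<psi>) \<Gamma>"
  have "proves L ?\<Delta> \<psi>"
    by (rule proves.ImpE[OF proves_insert proves_insertI[OF assms(3)]]) (simp add: assms)
  then show "proves L ?\<Delta> Bot"
    by (rule proves_NegE[OF proves_insertI[OF assms(4)]])
qed (use assms in auto)

lemma proves_contrapos:
  assumes "wf_fm L \<phi>" "proves L {\<phi>} \<psi>" "proves L \<Gamma> (Neg \<psi>)"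
  shows "proves L \<Gamma> (Neg \<phi>)"
proof (rule proves_NegI[OF assms(1)])
  show "proves L (insert \<phi> \<Gamma>) Bot"
    by (rule proves_NegE[OF proves_insertI[OF assms(3)] proves_weaken[OF assms(2)]]) auto
qed

lemma proves_Neg_NegD:
  assumes "wf_fm L \<phi>" "proves L \<Gamma> (Neg (Neg \<phi>))"
  shows "proves L \<Gamma> \<phi>"
  by (rule proves.Contr[OF assms(1) proves_NegE[OF proves_insertI[OF assms(2)] proves_insert]])
    (simp add: assms(1))

section \<open>Theories\<close>

lemma theory_subset: "is_theory L T \<Longrightarrow> T \<subseteq> sentences L"
  by (simp add: is_theory_def)

lemma theory_mem_iff: "is_theory L T \<Longrightarrow> \<phi> \<in> sentences L \<Longrightarrow> proves L T \<phi> \<longleftrightarrow> \<phi> \<in> T"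
  by (auto simp: is_theory_def intro: proves.Assm wf_sentence)

lemma provables_theory: "is_theory L T \<Longrightarrow> provables L T = T"
  using theory_subset[of L T] by (auto simp: provables_def theory_mem_iff)

lemma refutables_theory: "is_theory L T \<Longrightarrow> refutables L T = {\<phi>. Neg \<phi> \<in> T}"
  using theory_subset[of L T] by (force simp: refutables_def theory_mem_iff)

lemma consistent_disjoint:
  "is_theory L T \<Longrightarrow> consistent L T \<Longrightarrow> \<phi> \<in> T \<Longrightarrow> Neg \<phi> \<notin> T"
  using theory_subset[of L T] unfolding consistent_def
  by (meson proves_NegE subsetD sentences_simps(4) theory_mem_iff)

lemma Bot_notin_consistent: "is_theory L T \<Longrightarrow> consistent L T \<Longrightarrow> Bot \<notin> T"
  by (simp add: consistent_def flip: theory_mem_iff)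

lemma Top_in_theory: "is_theory L T \<Longrightarrow> Top \<in> T"
  by (simp add: proves_Top flip: theory_mem_iff)

lemma filter_theory:
  assumes S: "is_theory L S" and "consistent L S"
  shows "is_filter L S"
proof -
  have "\<beta> \<in> S" if "\<beta> \<in> sentences L" "\<alpha> \<in> S" "proves L {\<alpha>} \<beta>" for \<alpha> \<beta>
    using that theory_mem_iff[OF S that(1)] proves_weaken[of L "{\<alpha>}" \<beta> S] by auto
  moreover have "And \<alpha> \<beta> \<in> S" if "\<alpha> \<in> S" "\<beta> \<in> S" for \<alpha> \<beta>
  proof -
    from that theory_subset[OF S] have "\<alpha> \<in> sentences L" "\<beta> \<in> sentences L" by auto
    with that S show ?thesis
      by (simp add: proves_AndI wf_sentence flip: theory_mem_iff)
  qed
  ultimately show ?thesis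
    using theory_subset[OF S] Bot_notin_consistent[OF assms] unfolding is_filter_def by blast
qed

lemma ideal_refutables:
  assumes S: "is_theory L S" and "consistent L S"
  shows "is_ideal L (refutables L S)"
proof -
  have "\<beta> \<in> refutables L S"
    if "\<beta> \<in> sentences L" "\<alpha> \<in> refutables L S" "proves L {\<beta>} \<alpha>" for \<alpha> \<beta>
    using that proves_contrapos[of L \<beta> \<alpha> S] by (auto simp: refutables_def wf_sentence)
  moreover have "Or \<alpha> \<beta> \<in> refutables L S" if "\<alpha> \<in> refutables L S" "\<beta> \<in> refutables L S" for \<alpha> \<beta>
    using that by (auto simp: refutables_def wf_sentence intro: proves_Neg_OrI)
  moreover have "Top \<notin> refutables L S"
    using assms(2) proves_NegE[OF _ proves_Top] by (auto simp: refutables_def consistent_def)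
  moreover have "refutables L S \<subseteq> sentences L"
    by (auto simp: refutables_def)
  ultimately show ?thesis unfolding is_ideal_def by blast
qed

text \<open>By the deduction theorem this is the closure of \<open>T\<close> together with
  \<open>\<phi>\<close>, stated without derivations so that it is enumerable whenever
  \<open>T\<close> is.\<close>

definition extend :: "signature \<Rightarrow> fm set \<Rightarrow> fm \<Rightarrow> fm set" where
  "extend L T \<phi> = {\<psi>. Imp \<phi> \<psi> \<in> T}"

lemma extend_theory:
  assumes T: "is_theory L T" and \<phi>: "\<phi> \<in> sentences L"
  shows "is_theory L (extend L T \<phi>)"
proof -
  have sub: "extend L T \<phi> \<subseteq> sentences L"
    using theory_subset[OF T] by (auto simp: extend_def)
  have "\<psi> \<in> extend L T \<phi>" if \<psi>: "\<psi> \<in> sentences L" and "proves L (extend L T \<phi>) \<psi>" for \<psi>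
  proof -
    \<comment> \<open>Every member of the extension follows from \<open>insert \<phi> T\<close> by
      modus ponens; after the cut, \<open>\<phi>\<close> is discharged.\<close>
    have "proves L (insert \<phi> T \<union> {}) \<psi>"
    proof (rule proves_cut[OF that(2)])
      fix \<chi> assume "\<chi> \<in> extend L T \<phi>"
      then have "Imp \<phi> \<chi> \<in> T" by (simp add: extend_def)
      then have "proves L T (Imp \<phi> \<chi>)"
        using theory_mem_iff[OF T] theory_subset[OF T] by blast
      then show "proves L (insert \<phi> T) \<chi>"
        by (rule proves.ImpE[OF proves_insertI proves_insert[OF wf_sentence[OF \<phi>]]])
    qed (use sub \<phi> theory_subset[OF T] in auto)
    then have "proves L T (Imp \<phi> \<psi>)"
      by (intro proves.ImpI wf_sentence[OF \<phi>]) simp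
    then show ?thesis using theory_mem_iff[OF T, of "Imp \<phi> \<psi>"] \<phi> \<psi> by (simp add: extend_def)
  qed
  with sub show ?thesis unfolding is_theory_def by blast
qed

lemma extend_superset: "is_theory L T \<Longrightarrow> \<phi> \<in> sentences L \<Longrightarrow> T \<subseteq> extend L T \<phi>"
proof
  fix \<psi> assume T: "is_theory L T" and "\<phi> \<in> sentences L" "\<psi> \<in> T"
  moreover from this have "\<psi> \<in> sentences L" using theory_subset by blast
  ultimately have "proves L T (Imp \<phi> \<psi>)"
    by (intro proves.ImpI proves_insertI) (auto simp: wf_sentence theory_mem_iff)
  with T \<open>\<phi> \<in> sentences L\<close> \<open>\<psi> \<in> sentences L\<close> show "\<psi> \<in> extend L T \<phi>"
    by (simp add: extend_def theory_mem_iff)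
qed

lemma mem_extend_self: "is_theory L T \<Longrightarrow> \<phi> \<in> sentences L \<Longrightarrow> \<phi> \<in> extend L T \<phi>"
  using proves.ImpI[OF wf_sentence proves_insert[OF wf_sentence], of \<phi> L T]
  by (simp add: extend_def flip: theory_mem_iff)

text \<open>\<open>Neg \<phi>\<close> is by definition \<open>Imp \<phi> Bot\<close>, so
  \<open>Bot\<close> lies in the extension exactly when \<open>Neg \<phi>\<close> lies in
  \<open>T\<close>.\<close>

lemma consistent_extend:
  assumes "is_theory L T" "\<phi> \<in> sentences L" "Neg \<phi> \<notin> T"
  shows "consistent L (extend L T \<phi>)"
  using assms theory_mem_iff[OF extend_theory[OF assms(1,2)], of Bot]
  by (simp add: consistent_def extend_def Neg_def)

section \<open>Implication and negation on Goedel numbers\<close>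

lemma gn_eq_iff: "gn \<phi> = gn \<psi> \<longleftrightarrow> \<phi> = \<psi>"
  using gn_inject by blast

lemma gn_image_iff: "gn \<phi> \<in> gn ` T \<longleftrightarrow> \<phi> \<in> T"
  by (auto simp: gn_eq_iff)

abbreviation gn_imp :: "nat \<Rightarrow> nat \<Rightarrow> nat" where "gn_imp m n \<equiv> pair 3 (pair m n)"
abbreviation gn_neg :: "nat \<Rightarrow> nat" where "gn_neg n \<equiv> gn_imp n (pair 0 0)"

lemma gn_imp: "gn_imp (gn \<phi>) (gn \<psi>) = gn (Imp \<phi> \<psi>)" and gn_neg: "gn_neg (gn \<phi>) = gn (Neg \<phi>)"
  by (simp_all add: Neg_def)

text \<open>The numbers \<open>m\<close> and \<open>n\<close> are arbitrary: an output of the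
  extension function is not known in advance to number a formula, and an implication in
  \<open>T\<close> read backwards shows that it does.\<close>

lemma gn_imp_mem_iff: "gn_imp m n \<in> gn ` T \<longleftrightarrow> (\<exists>\<phi> \<psi>. m = gn \<phi> \<and> n = gn \<psi> \<and> Imp \<phi> \<psi> \<in> T)"
proof
  assume "gn_imp m n \<in> gn ` T"
  then obtain \<chi> where "\<chi> \<in> T" "gn_imp m n = gn \<chi>" by blast
  then show "\<exists>\<phi> \<psi>. m = gn \<phi> \<and> n = gn \<psi> \<and> Imp \<phi> \<psi> \<in> T" by (cases \<chi>) auto
qed (auto simp: image_iff intro!: bexI)

lemma gn_imp_mem_sentences: "gn_imp m n \<in> gn ` sentences L \<Longrightarrow> m \<in> gn ` sentences L"
  unfolding gn_imp_mem_iff by auto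

lemma gn_refutables: "is_theory L T \<Longrightarrow> gn ` refutables L T = {n. gn_neg n \<in> gn ` T}"
proof -
  assume T: "is_theory L T"
  have "gn_neg n \<in> gn ` T \<longleftrightarrow> (\<exists>\<phi>. n = gn \<phi> \<and> Neg \<phi> \<in> T)" for n
  proof -
    have "pair 0 0 = gn \<psi> \<longleftrightarrow> \<psi> = Bot" for \<psi>
      using gn_inject[of Bot \<psi>] by auto
    then show ?thesis unfolding gn_imp_mem_iff by (auto simp: Neg_def)
  qed
  then show ?thesis by (auto simp: refutables_theory[OF T])
qed

lemma gn_extend: "gn ` extend L T \<phi> = {n. gn_imp (gn \<phi>) n \<in> gn ` T}"
  unfolding gn_imp_mem_iff extend_def by (auto simp: gn_eq_iff)

section \<open>The equivalences\<close>

lemma EI_imp_tEI: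
  assumes T: "is_theory L T" and "EI L T"
  shows "tEI L T"
proof -
  from \<open>EI L T\<close> obtain f where "recursive2 f"
    and f: "\<forall>i j. gn ` provables L T \<subseteq> W i \<and> gn ` refutables L T \<subseteq> W j \<and> W i \<inter> W j = {} \<longrightarrow>
      (\<exists>n. f i j = Some n \<and> n \<notin> W i \<union> W j)"
    unfolding EI_def EI_pair_def by blast
  from \<open>recursive2 f\<close> obtain c where f_eq: "\<And>i j. f i j = eval c [i, j]"
    unfolding recursive2_def by blast
  note c = f[unfolded f_eq, rule_format, OF conjI[OF _ conjI]]
  let ?R = "\<lambda>i n. (\<exists>v. eval_code i n v) \<or> n \<notin> gn ` sentences L"
  have "semidecidable (\<lambda>z. ?R (pfst z) (psnd z))"
    by (intro semidecidable_disj semidecidable_ex semidecidable_eval_code computable_intros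
        semidecidable_comp[OF semidecidable_not_sentence])
  then obtain s where "computable s" and s: "\<And>i n. n \<in> W (s i) \<longleftrightarrow> ?R i n"
    by (rule smn_theorem[of ?R]) (rule that)
  then obtain d where d: "\<And>i. eval d [i] = Some (s i)"
    unfolding computable_def by blast
  show ?thesis unfolding tEI_def recursive2_def
  proof (intro exI[of _ "\<lambda>i j. eval c [s i, j]"] conjI allI impI; (elim conjE)?)
    show "\<exists>c'. \<forall>i j. eval c [s i, j] = eval c' [i, j]"
      by (rule exI[of _ "Comp c [Comp d [Proj 0], Proj 1]"]) (simp add: d)
    fix i j X Y
    assume X: "is_filter L X" "gn ` X = W i" and Y: "is_ideal L Y" "gn ` Y = W j"
      and sub: "provables L T \<subseteq> X" "refutables L T \<subseteq> Y" and disj: "X \<inter> Y = {}"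
    \<comment> \<open>\<open>Top\<close> makes \<open>W i\<close> nonempty, so \<open>i\<close> is a
      code and \<open>eval_code i\<close> describes \<open>W i\<close> correctly.\<close>
    have "Top \<in> X" using sub(1) Top_in_theory[OF T] provables_theory[OF T] by blast
    then have "W i \<noteq> {}" using X(2) by blast
    then have W: "n \<in> W (s i) \<longleftrightarrow> n \<in> W i \<or> n \<notin> gn ` sentences L" for n
      using s[of n i] mem_W_iff_eval_code[of i n] by blast
    have A: "gn ` provables L T \<subseteq> W (s i)"
      using image_mono[OF sub(1), of gn] X(2) W by blast
    have B: "gn ` refutables L T \<subseteq> W j"
      using image_mono[OF sub(2), of gn] Y(2) by simp
    have "gn \<phi> \<notin> W j" if "\<phi> \<in> X" for \<phi>
      using that disj gn_image_iff[of \<phi> Y] unfolding Y(2) by blast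
    then have "W i \<inter> W j = {}" unfolding X(2)[symmetric] by blast
    \<comment> \<open>The non-sentences added to the filter cannot meet the ideal, which consists of
      sentences.\<close>
    moreover have "Y \<subseteq> sentences L" using Y(1) unfolding is_ideal_def by (rule conjunct1)
    then have "W j \<subseteq> gn ` sentences L" unfolding Y(2)[symmetric] by (rule image_mono)
    ultimately have "W (s i) \<inter> W j = {}" using W by blast
    from c[OF A B this] obtain n where n: "eval c [s i, j] = Some n" "n \<notin> W (s i)" "n \<notin> W j"
      by blast
    then obtain \<phi> where "\<phi> \<in> sentences L" "n = gn \<phi>" using W by blast
    with n W show "\<exists>\<phi>\<in>sentences L. eval c [s i, j] = Some (gn \<phi>) \<and> \<phi> \<notin> X \<union> Y"
      using gn_image_iff[of \<phi> X] gn_image_iff[of \<phi> Y] unfolding X(2) Y(2) by blast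
  qed
qed

lemma tEI_imp_EET:
  assumes T: "is_theory L T" and "tEI L T"
  shows "EET L T"
proof -
  from \<open>tEI L T\<close> obtain f where "recursive2 f"
    and f: "\<forall>i j X Y. is_filter L X \<and> gn ` X = W i \<and> is_ideal L Y \<and> gn ` Y = W j \<and>
      provables L T \<subseteq> X \<and> refutables L T \<subseteq> Y \<and> X \<inter> Y = {} \<longrightarrow>
      (\<exists>\<phi>\<in>sentences L. f i j = Some (gn \<phi>) \<and> \<phi> \<notin> X \<union> Y)"
    unfolding tEI_def by blast
  from \<open>recursive2 f\<close> obtain c where f_eq: "\<And>i j. f i j = eval c [i, j]"
    unfolding recursive2_def by blast
  note c = f[unfolded f_eq, rule_format, OF conjI[OF _ conjI[OF _ conjI[OF _ conjI[OF _ conjI[OF _ conjI]]]]]]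
  \<comment> \<open>The preimage of \<open>W i\<close> under coded negation; if \<open>i\<close> is
    an index of a theory, these are the numbers of its refutable sentences.\<close>
  let ?R = "\<lambda>i n. \<exists>v. eval_code i (gn_neg n) v"
  have "semidecidable (\<lambda>z. ?R (pfst z) (psnd z))"
    by (intro semidecidable_ex semidecidable_eval_code computable_intros)
  then obtain s where "computable s" and s: "\<And>i n. n \<in> W (s i) \<longleftrightarrow> ?R i n"
    by (rule smn_theorem[of ?R]) (rule that)
  then obtain d where d: "\<And>i. eval d [i] = Some (s i)"
    unfolding computable_def by blast
  show ?thesis unfolding EET_def recursive1_def
  proof (intro exI[of _ "\<lambda>i. eval c [i, s i]"] conjI allI impI; (elim conjE)?)
    show "\<exists>c'. \<forall>i. eval c [i, s i] = eval c' [i]"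
      by (rule exI[of _ "Comp c [Proj 0, d]"]) (simp add: d)
    fix i S
    assume S: "is_theory L S" "consistent L S" "T \<subseteq> S" "gn ` S = W i"
    have "W i \<noteq> {}" using Top_in_theory[OF S(1)] S(4) by blast
    then have "gn_neg n \<in> W i \<longleftrightarrow> n \<in> W (s i)" for n
      using s[of n i] mem_W_iff_eval_code[of i "gn_neg n"] by blast
    then have R: "gn ` refutables L S = W (s i)"
      unfolding gn_refutables[OF S(1)] S(4) by blast
    have P: "provables L T \<subseteq> S"
      using provables_theory[OF T] S(3) by simp
    have R': "refutables L T \<subseteq> refutables L S"
      using S(3) by (auto simp: refutables_theory T S(1))
    have "S \<inter> refutables L S = {}"
      using consistent_disjoint[OF S(1,2)] by (auto simp: refutables_theory S(1))
    from c[OF filter_theory[OF S(1,2)] S(4) ideal_refutables[OF S(1,2)] R P R' this]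
    obtain \<phi> where "\<phi> \<in> sentences L" "eval c [i, s i] = Some (gn \<phi>)" "\<phi> \<notin> S \<union> refutables L S"
      by blast
    then show "\<exists>\<phi>\<in>sentences L. eval c [i, s i] = Some (gn \<phi>) \<and> \<not> proves L S \<phi> \<and> \<not> proves L S (Neg \<phi>)"
      using S(1) by (auto simp: refutables_def theory_mem_iff)
  qed
qed

lemma EET_imp_EI:
  assumes "RE_theory L T" and con: "consistent L T" and "EET L T"
  shows "EI L T"
proof -
  from assms(1) have T: "is_theory L T" and "RE (gn ` T)"
    unfolding RE_theory_def by auto
  then have sd: "semidecidable (\<lambda>n. n \<in> gn ` T)" by (simp add: RE_iff_semidecidable)
  from \<open>EET L T\<close> obtain f where "recursive1 f"
    and f: "\<forall>i S. is_theory L S \<and> consistent L S \<and> T \<subseteq> S \<and> gn ` S = W i \<longrightarrow>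
      (\<exists>\<phi>\<in>sentences L. f i = Some (gn \<phi>) \<and> \<not> proves L S \<phi> \<and> \<not> proves L S (Neg \<phi>))"
    unfolding EET_def by blast
  from \<open>recursive1 f\<close> obtain c where f_eq: "\<And>i. f i = eval c [i]"
    unfolding recursive1_def by blast
  note c = f[unfolded f_eq, rule_format, OF conjI[OF _ conjI[OF _ conjI]]]
  \<comment> \<open>\<open>p\<close> codes the pair of \<open>i\<close> and \<open>j\<close>, and
    \<open>n\<close> is the value of the extension function at \<open>e\<close>. The first disjunct
    keeps \<open>T\<close> in the set even while no such \<open>n\<close> is found.\<close>
  let ?R = "\<lambda>e p x. x \<in> gn ` T \<or> (\<exists>n. eval_code (code c) e n \<and>
      (((\<exists>v. eval_code (pfst p) n v) \<and> gn_imp n x \<in> gn ` T) \<or>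
       ((\<exists>v. eval_code (psnd p) n v) \<and> gn_imp (gn_neg n) x \<in> gn ` T)))"
  have "semidecidable (\<lambda>z. ?R (pfst z) (pfst (psnd z)) (psnd (psnd z)))"
    by (intro semidecidable_disj semidecidable_conj semidecidable_ex semidecidable_eval_code
        semidecidable_comp[OF sd] computable_intros)
  then obtain s where "computable s" and s: "\<And>p x. x \<in> W (s p) \<longleftrightarrow> ?R (s p) p x"
    by (rule recursion_theorem[of ?R]) (rule that)
  then obtain d where d: "\<And>p. eval d [p] = Some (s p)"
    unfolding computable_def by blast
  have sep: "\<exists>n. eval c [s (pair i j)] = Some n \<and> n \<notin> W i \<union> W j"
    if A: "gn ` provables L T \<subseteq> W i" and B: "gn ` refutables L T \<subseteq> W j" and disj: "W i \<inter> W j = {}"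
    for i j
  proof -
    let ?e = "s (pair i j)"
    have "Top \<in> T" using Top_in_theory[OF T] .
    \<comment> \<open>Since \<open>Top\<close> is \<open>Neg Bot\<close>, the sentence
      \<open>Bot\<close> is refutable, which makes \<open>W j\<close> nonempty.\<close>
    moreover have "Neg Bot \<in> T" using \<open>Top \<in> T\<close> unfolding Top_def .
    ultimately have ne: "W i \<noteq> {}" "W j \<noteq> {}"
      using A B unfolding provables_theory[OF T] refutables_theory[OF T] by blast+
    have We: "x \<in> W ?e \<longleftrightarrow> x \<in> gn ` T \<or> (\<exists>n. eval c [?e] = Some n \<and>
        ((n \<in> W i \<and> gn_imp n x \<in> gn ` T) \<or> (n \<in> W j \<and> gn_imp (gn_neg n) x \<in> gn ` T)))" for x
      using s[of x "pair i j"] mem_W_iff_eval_code[OF ne(1)] mem_W_iff_eval_code[OF ne(2)]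
      by (simp add: eval_code_iff)
    \<comment> \<open>\<open>\<chi>\<close> is \<open>\<phi>\<close> or its negation, so both cases
      share one argument: the extension contains \<open>\<chi>\<close>, but at its index the
      function returns a sentence independent of it.\<close>
    have contra: False
      if "\<phi> \<in> sentences L" "eval c [?e] = Some (gn \<phi>)" "gn ` extend L T \<chi> = W ?e"
        "\<chi> \<in> sentences L" "Neg \<chi> \<notin> T" "\<chi> = \<phi> \<or> \<chi> = Neg \<phi>" for \<phi> \<chi>
    proof -
      have ext: "is_theory L (extend L T \<chi>)" using T that(4) by (rule extend_theory)
      from c[OF ext consistent_extend[OF T that(4,5)] extend_superset[OF T that(4)] that(3)] that(2)
      have "\<not> proves L (extend L T \<chi>) \<phi>" "\<not> proves L (extend L T \<chi>) (Neg \<phi>)"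
        by (auto simp: gn_eq_iff)
      with that(6) mem_extend_self[OF T that(4)] theory_mem_iff[OF ext that(4)] show False by auto
    qed
    have notin: "gn \<phi> \<notin> W i \<union> W j" if \<phi>: "\<phi> \<in> sentences L" "eval c [?e] = Some (gn \<phi>)" for \<phi>
    proof
      assume "gn \<phi> \<in> W i \<union> W j"
      then consider (i) "gn \<phi> \<in> W i" "gn \<phi> \<notin> W j" | (j) "gn \<phi> \<in> W j" "gn \<phi> \<notin> W i"
        using disj by blast
      then show False
      proof cases
        case i
        then have "x \<in> W ?e \<longleftrightarrow> x \<in> gn ` T \<or> gn_imp (gn \<phi>) x \<in> gn ` T" for x
          using We[of x] \<phi>(2) by simp
        moreover have "gn ` T \<subseteq> gn ` extend L T \<phi>"
          using extend_superset[OF T \<phi>(1)] by (rule image_mono)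
        ultimately have ext: "gn ` extend L T \<phi> = W ?e"
          unfolding gn_extend by blast
        \<comment> \<open>Disjointness yields consistency: \<open>\<phi>\<close> is not in
          \<open>W j\<close>, hence not refutable in \<open>T\<close>.\<close>
        have "Neg \<phi> \<notin> T"
          using i(2) B unfolding refutables_theory[OF T] by blast
        from contra[OF \<phi> ext \<phi>(1) this] show False by simp
      next
        case j
        then have "x \<in> W ?e \<longleftrightarrow> x \<in> gn ` T \<or> gn_imp (gn (Neg \<phi>)) x \<in> gn ` T" for x
          using We[of x] \<phi>(2) by (simp add: gn_neg[symmetric])
        moreover have "Neg \<phi> \<in> sentences L" using \<phi>(1) by simp
        note Neg = this
        have "gn ` T \<subseteq> gn ` extend L T (Neg \<phi>)"
          using extend_superset[OF T Neg] by (rule image_mono)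
        ultimately have ext: "gn ` extend L T (Neg \<phi>) = W ?e"
          unfolding gn_extend by blast
        have "\<phi> \<notin> T"
          using j(2) A unfolding provables_theory[OF T] by blast
        \<comment> \<open>Consistency of the extension by \<open>Neg \<phi>\<close> concerns the
          double negation, which classically brings the goal back to
          \<open>\<phi> \<notin> T\<close>.\<close>
        then have "Neg (Neg \<phi>) \<notin> T"
          using proves_Neg_NegD[OF wf_sentence[OF \<phi>(1)], of T] theory_mem_iff[OF T \<phi>(1)]
            theory_mem_iff[OF T, of "Neg (Neg \<phi>)"] \<phi>(1) by auto
        from contra[OF \<phi> ext Neg this] show False by simp
      qed
    qed
    \<comment> \<open>\<open>notin\<close> speaks of sentences only. Any element outside
      \<open>T\<close> enters through an implication in \<open>T\<close> whose antecedent is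
      \<open>n\<close> or its negation, and this makes \<open>n\<close> the number of a
      sentence.\<close>
    have "W ?e = gn ` T"
    proof (rule ccontr)
      assume "W ?e \<noteq> gn ` T"
      then obtain n x where n: "eval c [?e] = Some n" "n \<in> W i \<union> W j"
        and "gn_imp n x \<in> gn ` T \<or> gn_imp (gn_neg n) x \<in> gn ` T"
        using We by blast
      then have "n \<in> gn ` sentences L"
        using gn_imp_mem_sentences theory_subset[OF T] by (metis image_mono subsetD)
      then obtain \<phi> where "n = gn \<phi>" "\<phi> \<in> sentences L" by blast
      with notin n show False by blast
    qed
    \<comment> \<open>With \<open>e\<close> now an index of \<open>T\<close> itself, the extension
      function converges at \<open>e\<close> to a sentence, and \<open>notin\<close> places it
      outside both sets.\<close>
    from c[OF T con order_refl this[symmetric]] notin show ?thesis by blast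
  qed
  show ?thesis unfolding EI_def EI_pair_def recursive2_def
  proof (intro conjI exI[of _ "\<lambda>i j. eval c [s (pair i j)]"] allI impI)
    show "RE (gn ` provables L T)"
      unfolding provables_theory[OF T] by fact
    show "RE (gn ` refutables L T)"
      unfolding RE_iff_semidecidable gn_refutables[OF T] mem_Collect_eq
      by (intro semidecidable_comp[OF sd] computable_intros)
    show "gn ` provables L T \<inter> gn ` refutables L T = {}"
      unfolding provables_theory[OF T] refutables_theory[OF T]
      using consistent_disjoint[OF T con] by (auto simp: gn_eq_iff)
    show "\<exists>c'. \<forall>i j. eval c [s (pair i j)] = eval c' [i, j]"
      by (rule exI[of _ "Comp c [Comp d [pair_prog]]"]) (simp add: d)
  qed (elim conjE, rule sep)
qed

theorem theorem3p11:
  fixes L :: signature and T :: "fm set"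
  assumes "RE_theory L T" and "consistent L T"
  shows "(EI L T \<longleftrightarrow> tEI L T) \<and> (tEI L T \<longleftrightarrow> EET L T)"
  using EI_imp_tEI tEI_imp_EET EET_imp_EI assms unfolding RE_theory_def by blast

end
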